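(* Let $\{\mathbf{H}^{[i]}\}_{i=0}^\infty$ be a sequence of channels that lie within a compact set $\mathcal{H}$ of strictly $\gamma_k$-feasible channels. Given arbitrary positive constants $\epsilon_1>0$ and $\epsilon_2>0$, there is some $\delta>0$ for which the ADMM algorithm described in the context (one iteration per channel change, iteration $i$ using $\mathbf{H}^{[i]}$) generates a sequence of beam-formers $\mathbf{W}^{[i]}$ for which the distance to the $\gamma_k$-optimal beam-formers is guaranteed to fulfill $$\limsup_{i\to\infty}\|\mathbf{W}^{[i]}-\mathbf{W}^{[i]\star}\|_{\mathrm F}^2\le\epsilon_1,$$ where $\mathbf{W}^{[i]\star}$ denotes the optimal beam-formers at time $i$ (the optimal solution of the centralized problem for the channels $\mathbf{H}^{[i]}$), and the SINR of all users $k$ (with $b=b(k)$) are guaranteed to fulfill $$\liminf_{i\to\infty}\ \mathrm{SINR}_k(\mathbf{W}^{[i]},\mathbf{H}^{[i]},\mathbf{t}_b^{[i]})\ge\gamma_k-\epsilon_2,$$ whenever $\|\mathbf{H}^{[i]}-\mathbf{H}^{[i-1]}\|\le\delta$ for all $i\ge 1$.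
   Context: Network. There are $B$ base stations with $N_T$ antennas each and $K$ single-antenna users. User $k$ is served by base station $b(k)$, and $\mathcal{U}(b)=\{k: b(k)=b\}$. $\mathbf{h}_{mk}\in\mathbb{C}^{N_T}$ is the channel from base station $m$ to user $k$, $\mathbf{H}$ is the matrix containing all channels, $\mathbf{w}_k\in\mathbb{C}^{N_T}$ is the beam-former used by base station $b(k)$ for user $k$, and $\mathbf{W}$ is the matrix containing all beam-formers. $\mathbf{H}_b$ and $\mathbf{W}_b$ denote the channels $\mathbf{h}_{bk}$, $k=1,\dots,K$, known to base station $b$ and the beam-formers $\mathbf{w}_k$, $k\in\mathcal{U}(b)$, used by it. Noise variances $\sigma_k^2$ and targets $\gamma_k>0$ are fixed. Centralized problem: minimize $\sum_{b=1}^B\sum_{k\in\mathcal{U}(b)}\|\mathbf{w}_k\|^2$ subject to, for all $k=1,\dots,K$, $$\mathrm{SINR}_k(\mathbf{W},\mathbf{H})=\frac{|\mathbf{h}_{b(k)k}^H\mathbf{w}_k|^2}{\sum_{i\in\mathcal{U}(b(k))\setminus k}|\mathbf{h}_{b(k)k}^H\mathbf{w}_i|^2+\sum_{m\ne b(k)}\sum_{i\in\mathcal{U}(m)}|\mathbf{h}_{mk}^H\mathbf{w}_i|^2+\sigma_k^2}\ge\gamma_k.$$ The phase ambiguity of the beam-formers is removed by choosing phases so that the products $\mathbf{h}_{b(k)k}^H\mathbf{w}_k$ are real and positive, and the optimal solution is then treated as unique. Channels are strictly $\gamma_k$-feasible if the centralized problem is strictly feasible for them. Interference copies. For each user $k$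 and each $m\ne b(k)$ there are two real copies, $t_{mk}^{(m)}$ (held by base station $m$) and $t_{mk}^{(b(k))}$ (held by base station $b(k)$), of the quantity $t_{mk}$, where $t_{mk}^2$ is the power of the interference caused by base station $m$ on user $k$, and one consistency variable $\tau_{mk}\in\mathbb{R}$. $\mathbf{t}_b$ collects the copies held by base station $b$, i.e. $t_{bj}^{(b)}$ for $j\notin\mathcal{U}(b)$ and $t_{mk}^{(b)}$ for $k\in\mathcal{U}(b)$, $m\ne b$; $\mathbf{t}=(\mathbf{t}_1,\dots,\mathbf{t}_B)\in\mathbb{R}^{2(B-1)K}$, and $\boldsymbol{\tau}\in\mathbb{R}^{(B-1)K}$ collects the consistency variables. $\mathbf{E}$ is the $2(B-1)K\times(B-1)K$ zero-one matrix that copies each element of $\boldsymbol{\tau}$ into the positions of its copies in $\mathbf{t}$ (so the consistency requirement is $\mathbf{E}\boldsymbol{\tau}=\mathbf{t}$), $\mathbf{E}_b$ is its block of rows corresponding to $\mathbf{t}_b$, and $\mathbf{E}^\dagger$ is its pseudo-inverse (averaging the two copies). For $k\in\mathcal{U}(b)$ the SINR as a function of the local interference copies is $$\mathrm{SINR}_k(\mathbf{W}_b,\mathbf{H}_b,\mathbf{t}_b)=\frac{|\mathbf{h}_{bk}^H\mathbf{w}_k|^2}{\sum_{i\in\mathcal{U}(b)\setminus k}|\mathbf{h}_{bk}^H\mathbf{w}_i|^2+\sum_{m\ne b}(t_{mk}^{(b)})^2+\sigma_k^2}.$$ It depends only on the parts $\mathbf{W}_b,\mathbf{H}_b$ of $\mathbf{W},\mathbf{H}$,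 and $\mathrm{SINR}_k(\mathbf{W}^{[i]},\mathbf{H}^{[i]},\mathbf{t}_b^{[i]})$ denotes its value at $\mathbf{W}_b^{[i]},\mathbf{H}_b^{[i]},\mathbf{t}_b^{[i]}$. For $j\notin\mathcal{U}(b)$ let $$\mathrm{INT}_{bj}(\mathbf{W}_b,\mathbf{H}_b,\mathbf{t}_b)=\big(t_{bj}^{(b)}\big)^2-\sum_{i\in\mathcal{U}(b)}|\mathbf{h}_{bj}^H\mathbf{w}_i|^2.$$ ADMM algorithm with penalty parameter $\rho>0$: initialize $\boldsymbol{\tau}^{[0]}$ and $\boldsymbol{\nu}^{[0]}=(\boldsymbol{\nu}_1^{[0]},\dots,\boldsymbol{\nu}_B^{[0]})\in\mathbb{R}^{2(B-1)K}$ with $\mathbf{E}^T\boldsymbol{\nu}^{[0]}=\mathbf{0}$. For $i=1,2,\dots$: (1) for each $b$, obtain $\mathbf{w}_k^{[i]}$, $k\in\mathcal{U}(b)$, and $\mathbf{t}_b^{[i]}$ by minimizing over $\{\mathbf{w}_j\}_{j\in\mathcal{U}(b)}$ and $\mathbf{t}_b$ the function $\sum_{j\in\mathcal{U}(b)}\|\mathbf{w}_j\|^2+(\boldsymbol{\nu}_b^{[i-1]})^T(\mathbf{t}_b-\mathbf{E}_b\boldsymbol{\tau}^{[i-1]})+\frac{\rho}{2}\|\mathbf{t}_b-\mathbf{E}_b\boldsymbol{\tau}^{[i-1]}\|^2$ subject to $\mathrm{SINR}_k(\mathbf{W}_b,\mathbf{H}_b^{[i]},\mathbf{t}_b)\ge\gamma_k$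 for all $k\in\mathcal{U}(b)$ and $\mathrm{INT}_{bj}(\mathbf{W}_b,\mathbf{H}_b^{[i]},\mathbf{t}_b)\ge 0$ for all $j\notin\mathcal{U}(b)$; (2) set $\boldsymbol{\tau}^{[i]}=\mathbf{E}^\dagger\mathbf{t}^{[i]}$; (3) set $\boldsymbol{\nu}_b^{[i]}=\boldsymbol{\nu}_b^{[i-1]}+\rho(\mathbf{t}_b^{[i]}-\mathbf{E}_b\boldsymbol{\tau}^{[i]})$ for each $b$. $\mathbf{W}^{[i]}$ collects the $\mathbf{w}_k^{[i]}$.
   Formalization: In step (1) the constraint INT_bj ≥ 0 is imposed together with t_bj^(b) ≥ 0 for j not in U(b), as t is an interference amplitude; with negative t_bj^(b) allowed, the algorithm can fail to approach the optimum even for constant channels. *)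

theory Defs
  imports "HOL-Analysis.Analysis"
begin

text \<open>
  Base stations, users and antennas are indexed by finite types \<open>'b\<close>, \<open>'k\<close>, \<open>'n\<close>, and
  \<open>bs k\<close> is the base station serving user \<open>k\<close>. The channel from base station \<open>m\<close> to
  user \<open>k\<close> is \<open>H $ m $ k\<close>, the beam-former of user \<open>k\<close> is \<open>W $ k\<close>, and
  the library norm on both types is the Frobenius norm.
\<close>

type_synonym ('n, 'k, 'b) channels = "complex ^ 'n ^ 'k ^ 'b"
type_synonym ('n, 'k) beams = "complex ^ 'n ^ 'k"

text \<open>
  The pair \<open>(m, k)\<close> indexes the interference caused by \<open>m\<close> on \<open>k\<close>, and the triple
  \<open>(l, m, k)\<close> indexes the copy of that quantity held by base station \<open>l\<close>. Only pairs with
  \<open>m \<noteq> bs k\<close> and triples with moreover \<open>l \<in> {m, bs k}\<close> (see \<open>held\<close>) are meaningful; there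
  are \<open>(B - 1) K\<close> and \<open>2 (B - 1) K\<close> of these. The other coordinates are padding: the matrix
  \<open>copy_matrix\<close> vanishes on them, and no objective, constraint or beam-former depends on them.
\<close>

type_synonym ('k, 'b) links = "real ^ ('b \<times> 'k)"
type_synonym ('k, 'b) copies = "real ^ ('b \<times> 'b \<times> 'k)"

definition users :: "('k \<Rightarrow> 'b) \<Rightarrow> 'b \<Rightarrow> 'k set" where
  "users bs b = {k. bs k = b}"

definition hdot :: "complex ^ 'n \<Rightarrow> complex ^ 'n \<Rightarrow> complex" where
  "hdot h w = (\<Sum>a\<in>UNIV. cnj (h $ a) * w $ a)"


section \<open>The centralized problem\<close>

definition sinr ::
  "('k::finite \<Rightarrow> 'b::finite) \<Rightarrow> ('k \<Rightarrow> real) \<Rightarrow> ('n::finite, 'k, 'b) channels \<Rightarrow> ('n, 'k) beams \<Rightarrow> 'k \<Rightarrow> real"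
where
  "sinr bs \<sigma> H W k =
     (cmod (hdot (H $ bs k $ k) (W $ k)))\<^sup>2 /
     ((\<Sum>i\<in>users bs (bs k) - {k}. (cmod (hdot (H $ bs k $ k) (W $ i)))\<^sup>2)
      + (\<Sum>m\<in>UNIV - {bs k}. \<Sum>i\<in>users bs m. (cmod (hdot (H $ m $ k) (W $ i)))\<^sup>2)
      + (\<sigma> k)\<^sup>2)"

definition total_power :: "('k::finite \<Rightarrow> 'b::finite) \<Rightarrow> ('n::finite, 'k) beams \<Rightarrow> real" where
  "total_power bs W = (\<Sum>b\<in>UNIV. \<Sum>k\<in>users bs b. (norm (W $ k))\<^sup>2)"

definition feasible ::
  "('k::finite \<Rightarrow> 'b::finite) \<Rightarrow> ('k \<Rightarrow> real) \<Rightarrow> ('k \<Rightarrow> real) \<Rightarrow> ('n::finite, 'k, 'b) channels \<Rightarrow> ('n, 'k) beams \<Rightarrow> bool"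
where
  "feasible bs \<sigma> \<gamma> H W \<longleftrightarrow> (\<forall>k. sinr bs \<sigma> H W k \<ge> \<gamma> k)"

definition strictly_feasible ::
  "('k::finite \<Rightarrow> 'b::finite) \<Rightarrow> ('k \<Rightarrow> real) \<Rightarrow> ('k \<Rightarrow> real) \<Rightarrow> ('n::finite, 'k, 'b) channels \<Rightarrow> bool"
where
  "strictly_feasible bs \<sigma> \<gamma> H \<longleftrightarrow> (\<exists>W. \<forall>k. sinr bs \<sigma> H W k > \<gamma> k)"

definition phase_fixed ::
  "('k::finite \<Rightarrow> 'b::finite) \<Rightarrow> ('n::finite, 'k, 'b) channels \<Rightarrow> ('n, 'k) beams \<Rightarrow> bool"
where
  "phase_fixed bs H W \<longleftrightarrow>
     (\<forall>k. hdot (H $ bs k $ k) (W $ k) \<in> \<real> \<and> Re (hdot (H $ bs k $ k) (W $ k)) > 0)"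

definition optimal_beams ::
  "('k::finite \<Rightarrow> 'b::finite) \<Rightarrow> ('k \<Rightarrow> real) \<Rightarrow> ('k \<Rightarrow> real) \<Rightarrow> ('n::finite, 'k, 'b) channels \<Rightarrow> ('n, 'k) beams \<Rightarrow> bool"
where
  "optimal_beams bs \<sigma> \<gamma> H W \<longleftrightarrow>
     feasible bs \<sigma> \<gamma> H W \<and>
     (\<forall>W'. feasible bs \<sigma> \<gamma> H W' \<longrightarrow> total_power bs W \<le> total_power bs W') \<and>
     phase_fixed bs H W"


section \<open>Consistency matrix and pseudo-inverse\<close>

definition copy_matrix :: "('k::finite \<Rightarrow> 'b::finite) \<Rightarrow> real ^ ('b \<times> 'k) ^ ('b \<times> 'b \<times> 'k)" where
  "copy_matrix bs =
     (\<chi> c q. case c of (l, m, k) \<Rightarrow>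
        if q = (m, k) \<and> m \<noteq> bs k \<and> (l = m \<or> l = bs k) then 1 else 0)"

definition is_pinv :: "real ^ 'n ^ 'm \<Rightarrow> real ^ 'm ^ 'n \<Rightarrow> bool" where
  "is_pinv A X \<longleftrightarrow>
     A ** X ** A = A \<and> X ** A ** X = X \<and>
     transpose (A ** X) = A ** X \<and> transpose (X ** A) = X ** A"

definition pinv :: "real ^ 'n ^ 'm \<Rightarrow> real ^ 'm ^ 'n" where
  "pinv A = (THE X. is_pinv A X)"

lemma is_pinv_unique:
  fixes A :: "real ^ 'n ^ 'm"
  assumes X: "is_pinv A X" and Y: "is_pinv A Y"
  shows "X = Y"
proof -
  have ax: "transpose (A ** X) = A ** X" and xa: "transpose (X ** A) = X ** A"
    and axa: "A ** X ** A = A" and xax: "X ** A ** X = X"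
    using X by (auto simp: is_pinv_def)
  have ay: "transpose (A ** Y) = A ** Y" and ya: "transpose (Y ** A) = Y ** A"
    and aya: "A ** Y ** A = A" and yay: "Y ** A ** Y = Y"
    using Y by (auto simp: is_pinv_def)
  have "A ** X = transpose ((A ** Y ** A) ** X)" by (simp only: aya ax)
  also have "\<dots> = transpose ((A ** Y) ** (A ** X))" by (simp only: matrix_mul_assoc)
  also have "\<dots> = (A ** X) ** (A ** Y)" by (subst matrix_transpose_mul) (simp only: ax ay)
  also have "\<dots> = (A ** X ** A) ** Y" by (simp only: matrix_mul_assoc)
  finally have 1: "A ** X = A ** Y" by (simp only: axa)
  have "X ** A = transpose (X ** (A ** Y ** A))" by (simp only: aya xa)
  also have "\<dots> = transpose ((X ** A) ** (Y ** A))" by (simp only: matrix_mul_assoc)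
  also have "\<dots> = (Y ** A) ** (X ** A)" by (subst matrix_transpose_mul) (simp only: xa ya)
  also have "\<dots> = Y ** (A ** X ** A)" by (simp only: matrix_mul_assoc)
  finally have 2: "X ** A = Y ** A" by (simp only: axa)
  have "X = (X ** A) ** X" by (simp only: xax)
  also have "\<dots> = Y ** (A ** X)" by (simp only: 2 matrix_mul_assoc)
  also have "\<dots> = Y" by (simp only: 1 yay matrix_mul_assoc)
  finally show ?thesis .
qed

lemma pinv_eqI: "is_pinv A X \<Longrightarrow> pinv A = X"
  unfolding pinv_def by (blast intro: is_pinv_unique)

lemma transpose_copy_matrix_mult:
  "transpose (copy_matrix bs) *v v =
     (\<chi> q. case q of (m, k) \<Rightarrow> if m \<noteq> bs k then v $ (m, m, k) + v $ (bs k, m, k) else 0)"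
proof -
  have "(transpose (copy_matrix bs) *v v) $ (m, k) =
      (if m \<noteq> bs k then v $ (m, m, k) + v $ (bs k, m, k) else 0)" for m k
  proof -
    let ?S = "if m \<noteq> bs k then {(m, m, k), (bs k, m, k)} else {}"
    have "(transpose (copy_matrix bs) *v v) $ (m, k) =
        (\<Sum>c\<in>UNIV. copy_matrix bs $ c $ (m, k) * v $ c)"
      by (simp add: matrix_vector_mult_def transpose_def del: transpose_matrix_vector)
    also have "\<dots> = (\<Sum>c\<in>UNIV. if c \<in> ?S then v $ c else 0)"
      by (rule sum.cong) (auto simp: copy_matrix_def split: if_splits prod.splits)
    also have "\<dots> = (\<Sum>c\<in>?S. v $ c)" by (simp add: sum.If_cases)
    finally show ?thesis by auto
  qed
  then show ?thesis by (auto simp: vec_eq_iff)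
qed

lemma copy_matrix_mult:
  "copy_matrix bs *v v =
     (\<chi> c. case c of (l, m, k) \<Rightarrow> if m \<noteq> bs k \<and> (l = m \<or> l = bs k) then v $ (m, k) else 0)"
proof -
  have "(copy_matrix bs *v v) $ (l, m, k) =
      (if m \<noteq> bs k \<and> (l = m \<or> l = bs k) then v $ (m, k) else 0)" for l m k
  proof -
    have "(copy_matrix bs *v v) $ (l, m, k) =
        (\<Sum>q\<in>UNIV. copy_matrix bs $ (l, m, k) $ q * v $ q)"
      by (simp add: matrix_vector_mult_def)
    also have "\<dots> = (\<Sum>q\<in>UNIV. if q = (m, k)
        then (if m \<noteq> bs k \<and> (l = m \<or> l = bs k) then v $ q else 0) else 0)"
      by (rule sum.cong) (auto simp: copy_matrix_def)
    finally show ?thesis by simp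
  qed
  then show ?thesis by (auto simp: vec_eq_iff)
qed

lemma pinv_copy_matrix: "pinv (copy_matrix bs) = (1/2) *\<^sub>R transpose (copy_matrix bs)"
proof (rule pinv_eqI)
  let ?E = "copy_matrix bs" and ?X = "(1/2::real) *\<^sub>R transpose (copy_matrix bs)"
  have E: "?E ** ?X ** ?E = ?E"
    unfolding matrix_eq
    by (auto simp: matrix_vector_mul_assoc[symmetric] scaleR_matrix_vector_assoc[symmetric]
        transpose_copy_matrix_mult copy_matrix_mult vec_eq_iff
        simp del: transpose_matrix_vector)
  have X: "?X ** ?E ** ?X = ?X"
    unfolding matrix_eq
    by (auto simp: matrix_vector_mul_assoc[symmetric] scaleR_matrix_vector_assoc[symmetric]
        transpose_copy_matrix_mult copy_matrix_mult vec_eq_iff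
        simp del: transpose_matrix_vector)
  have "transpose (?E ** ?X) = ?E ** ?X" "transpose (?X ** ?E) = ?X ** ?E"
    by (simp_all add: matrix_transpose_mul transpose_scalar scalar_matrix_assoc[symmetric]
        matrix_scalar_ac)
  with E X show "is_pinv ?E ?X" by (simp add: is_pinv_def)
qed

lemma pinv_copy_matrix_mult:
  assumes "m \<noteq> bs k"
  shows "(pinv (copy_matrix bs) *v t) $ (m, k) = (t $ (m, m, k) + t $ (bs k, m, k)) / 2"
  using assms
  by (simp add: pinv_copy_matrix scaleR_matrix_vector_assoc[symmetric] transpose_copy_matrix_mult
      del: transpose_matrix_vector)


section \<open>The local problems and the algorithm\<close>

definition held :: "('k \<Rightarrow> 'b) \<Rightarrow> 'b \<Rightarrow> ('b \<times> 'k) set" where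
  "held bs b = {(m, k). m \<noteq> bs k \<and> (b = m \<or> b = bs k)}"

definition local_sinr ::
  "('k::finite \<Rightarrow> 'b::finite) \<Rightarrow> ('k \<Rightarrow> real) \<Rightarrow> ('n::finite, 'k, 'b) channels \<Rightarrow> ('n, 'k) beams
    \<Rightarrow> ('k, 'b) copies \<Rightarrow> 'k \<Rightarrow> real"
where
  "local_sinr bs \<sigma> H W t k =
     (cmod (hdot (H $ bs k $ k) (W $ k)))\<^sup>2 /
     ((\<Sum>i\<in>users bs (bs k) - {k}. (cmod (hdot (H $ bs k $ k) (W $ i)))\<^sup>2)
      + (\<Sum>m\<in>UNIV - {bs k}. (t $ (bs k, m, k))\<^sup>2)
      + (\<sigma> k)\<^sup>2)"

definition int_slack ::
  "('k::finite \<Rightarrow> 'b::finite) \<Rightarrow> ('n::finite, 'k, 'b) channels \<Rightarrow> ('n, 'k) beams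
    \<Rightarrow> ('k, 'b) copies \<Rightarrow> 'b \<Rightarrow> 'k \<Rightarrow> real"
where
  "int_slack bs H W t b j =
     (t $ (b, b, j))\<^sup>2 - (\<Sum>i\<in>users bs b. (cmod (hdot (H $ b $ j) (W $ i)))\<^sup>2)"

text \<open>
  The copy of \<open>t\<close> that base station \<open>b\<close> holds for a foreign user \<open>j\<close> is an interference
  amplitude, so the interference constraint is taken on its nonnegative branch: together the two
  conjuncts on \<open>j\<close> say that \<open>t $ (b, b, j)\<close> is at least the Euclidean norm of the interference
  that \<open>b\<close> causes on \<open>j\<close>, a second-order cone constraint. Without the sign condition the
  constraint is non-convex, and even for constant channels the iteration need not approach the
  centralized optimum. The copies that enter the SINR constraints have no sign condition.
\<close>

definition local_feasible ::
  "('k::finite \<Rightarrow> 'b::finite) \<Rightarrow> ('k \<Rightarrow> real) \<Rightarrow> ('k \<Rightarrow> real) \<Rightarrow> ('n::finite, 'k, 'b) channels \<Rightarrow> 'b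
    \<Rightarrow> ('n, 'k) beams \<Rightarrow> ('k, 'b) copies \<Rightarrow> bool"
where
  "local_feasible bs \<sigma> \<gamma> H b W t \<longleftrightarrow>
     (\<forall>k\<in>users bs b. local_sinr bs \<sigma> H W t k \<ge> \<gamma> k) \<and>
     (\<forall>j. j \<notin> users bs b \<longrightarrow> int_slack bs H W t b j \<ge> 0 \<and> t $ (b, b, j) \<ge> 0)"

definition local_objective ::
  "('k::finite \<Rightarrow> 'b::finite) \<Rightarrow> real \<Rightarrow> ('k, 'b) links \<Rightarrow> ('k, 'b) copies \<Rightarrow> 'b
    \<Rightarrow> ('n::finite, 'k) beams \<Rightarrow> ('k, 'b) copies \<Rightarrow> real"
where
  "local_objective bs \<rho> \<tau> \<nu> b W t =
     (\<Sum>j\<in>users bs b. (norm (W $ j))\<^sup>2)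
     + (\<Sum>(m, k)\<in>held bs b. \<nu> $ (b, m, k) * (t $ (b, m, k) - (copy_matrix bs *v \<tau>) $ (b, m, k)))
     + \<rho> / 2 * (\<Sum>(m, k)\<in>held bs b. (t $ (b, m, k) - (copy_matrix bs *v \<tau>) $ (b, m, k))\<^sup>2)"

text \<open>
  Objective and constraints of base station \<open>b\<close> read only the beam-formers of its own users and
  the copies it holds, so minimizing over full \<open>W'\<close>, \<open>t'\<close> is minimizing over these local parts.
\<close>

definition local_minimizer ::
  "('k::finite \<Rightarrow> 'b::finite) \<Rightarrow> ('k \<Rightarrow> real) \<Rightarrow> ('k \<Rightarrow> real) \<Rightarrow> real \<Rightarrow> ('n::finite, 'k, 'b) channels
    \<Rightarrow> ('k, 'b) links \<Rightarrow> ('k, 'b) copies \<Rightarrow> 'b \<Rightarrow> ('n, 'k) beams \<Rightarrow> ('k, 'b) copies \<Rightarrow> bool"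
where
  "local_minimizer bs \<sigma> \<gamma> \<rho> H \<tau> \<nu> b W t \<longleftrightarrow>
     local_feasible bs \<sigma> \<gamma> H b W t \<and>
     (\<forall>W' t'. local_feasible bs \<sigma> \<gamma> H b W' t' \<longrightarrow>
        local_objective bs \<rho> \<tau> \<nu> b W t \<le> local_objective bs \<rho> \<tau> \<nu> b W' t')"

text \<open>
  The entries \<open>W 0\<close> and \<open>t 0\<close> play no role; the beam-formers are determined by the local problems
  up to the phases, which are fixed as in \<open>phase_fixed\<close>.
\<close>

definition admm_run ::
  "('k::finite \<Rightarrow> 'b::finite) \<Rightarrow> ('k \<Rightarrow> real) \<Rightarrow> ('k \<Rightarrow> real) \<Rightarrow> real
    \<Rightarrow> (nat \<Rightarrow> ('n::finite, 'k, 'b) channels) \<Rightarrow> (nat \<Rightarrow> ('n, 'k) beams)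
    \<Rightarrow> (nat \<Rightarrow> ('k, 'b) copies) \<Rightarrow> (nat \<Rightarrow> ('k, 'b) links) \<Rightarrow> (nat \<Rightarrow> ('k, 'b) copies) \<Rightarrow> bool"
where
  "admm_run bs \<sigma> \<gamma> \<rho> H W t \<tau> \<nu> \<longleftrightarrow>
     transpose (copy_matrix bs) *v \<nu> 0 = 0 \<and>
     (\<forall>i\<ge>1.
        (\<forall>b. local_minimizer bs \<sigma> \<gamma> \<rho> (H i) (\<tau> (i - 1)) (\<nu> (i - 1)) b (W i) (t i)) \<and>
        phase_fixed bs (H i) (W i) \<and>
        \<tau> i = pinv (copy_matrix bs) *v t i \<and>
        \<nu> i = \<nu> (i - 1) + \<rho> *\<^sub>R (t i - copy_matrix bs *v \<tau> i))"

end

theory Submission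
  imports Defs
begin

text \<open>
  Once the phases of the beam-formers are fixed, every constraint of the local problems is a
  second-order cone constraint, so for each channel \<open>H\<close> the beam-formers and copies that satisfy
  all of them form a closed convex set. The two pieces of memory of the algorithm enter the local
  objectives only through \<open>u = E \<tau> - \<nu> / \<rho>\<close>: in units of interference in which the penalty has weight one, the
  sum of the local objectives is, up to a constant, the squared distance from \<open>(W, t)\<close> to
  \<open>(0, u)\<close>. The local minimizations together are therefore the metric projection of \<open>(0, u)\<close>
  onto this convex set (\<open>prox_state\<close>), and with \<open>P = E E\<^sup>\<dagger>\<close> the complete iteration is
  \<open>u \<mapsto> P t + (u - t) - P (u - t)\<close> (\<open>state_step\<close>). This is the partial inverse method of
  Spingarn. It is firmly nonexpansive, and as the objective is strongly convex in the beam-formers,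
  the distance of \<open>u\<close> to a fixed point also bounds the distance of \<open>W\<close> to the beam-formers of
  that fixed point (\<open>step_firmly_nonexpansive\<close>).

  A fixed point is the sum of the optimal interference amplitudes and of a price vector. One exists
  by Slater's condition (\<open>multiplier_exists\<close>), and its beam-formers are those of the
  centralized problem (\<open>fixed_point_supports\<close>). The prices are unique
  (\<open>multiplier_unique\<close>): the difference of two price vectors is proportional, user by user, to the
  interference amplitudes, and the vector of factors of proportionality is annihilated by a
  strictly diagonally dominant matrix of gains. Slater's condition also makes the step jointly
  continuous in channel and state (\<open>continuous_step\<close>).

  Tracking then holds for any family of this kind (\<open>fixed_point_tracking\<close>): over a compact set
  of channels, the progress of a step from the sphere of radius \<open>r\<close> around the fixed point is
  bounded below, nonexpansiveness transports this bound radially to every state further away, and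
  the fixed point moves continuously with the channel. If it moves by less than the progress, every
  run ends up within about \<open>r\<close> of the fixed point, whatever its initialization. The bound on the
  SINR holds because every iterate satisfies the SINR constraint of its local problem.
\<close>

section \<open>Continuous families of convex constraints\<close>

definition sublevel :: "('i \<Rightarrow> 'h \<Rightarrow> 'z \<Rightarrow> real) \<Rightarrow> 'i set \<Rightarrow> 'h \<Rightarrow> 'z set" where
  "sublevel g I h = {z. \<forall>i\<in>I. g i h z \<le> 0}"

locale slater_family =
  fixes g :: "'i \<Rightarrow> 'h::metric_space \<Rightarrow> 'z::euclidean_space \<Rightarrow> real"
    and I :: "'i set" and K :: "'h set"
  assumes finite_I: "finite I"
    and continuous_g: "\<And>i. i \<in> I \<Longrightarrow> continuous_on UNIV (\<lambda>(h, z). g i h z)"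
    and convex_g: "\<And>i h. i \<in> I \<Longrightarrow> convex_on UNIV (g i h)"
    and slater: "\<And>h. h \<in> K \<Longrightarrow> \<exists>z. \<forall>i\<in>I. g i h z < 0"
begin

abbreviation Q :: "'h \<Rightarrow> 'z set" where
  "Q \<equiv> sublevel g I"

lemma tendsto_g:
  assumes "i \<in> I" "(hs \<longlongrightarrow> h) F" "(zs \<longlongrightarrow> z) F"
  shows "((\<lambda>n. g i (hs n) (zs n)) \<longlongrightarrow> g i h z) F"
proof -
  have "isCont (\<lambda>(h, z). g i h z) (h, z)"
    using continuous_g[OF assms(1)] by (simp add: continuous_on_eq_continuous_at)
  from isCont_tendsto_compose[OF this tendsto_Pair[OF assms(2,3)]] show ?thesis by simp
qed

lemma Q_limit:
  assumes "hs \<longlonglongrightarrow> h" "zs \<longlonglongrightarrow> z" "\<And>n. zs n \<in> Q (hs n)"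
  shows "z \<in> Q h"
  unfolding sublevel_def
proof safe
  fix i assume i: "i \<in> I"
  show "g i h z \<le> 0"
    using i assms(3) by (intro LIMSEQ_le_const2[OF tendsto_g[OF i assms(1,2)]]) (auto simp: sublevel_def)
qed

lemma closed_Q: "closed (Q h)"
  unfolding closed_sequential_limits using Q_limit[of "\<lambda>_. h"] by auto

lemma convex_Q: "convex (Q h)"
  unfolding convex_alt
proof (intro ballI allI impI)
  fix x y u assume xy: "x \<in> Q h" "y \<in> Q h" and u: "0 \<le> u \<and> u \<le> (1::real)"
  have "g i h ((1 - u) *\<^sub>R x + u *\<^sub>R y) \<le> 0" if i: "i \<in> I" for i
  proof -
    have "g i h ((1 - u) *\<^sub>R x + u *\<^sub>R y) \<le> (1 - u) * g i h x + u * g i h y"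
      using convex_onD[OF convex_g[OF i]] u by auto
    also have "\<dots> \<le> 0" using xy u i
      by (auto simp: sublevel_def intro!: add_nonpos_nonpos mult_nonneg_nonpos)
    finally show ?thesis .
  qed
  then show "(1 - u) *\<^sub>R x + u *\<^sub>R y \<in> Q h" by (simp add: sublevel_def)
qed

lemma Q_nonempty: "h \<in> K \<Longrightarrow> Q h \<noteq> {}"
  using slater[of h] unfolding sublevel_def by (fastforce intro: less_imp_le)

text \<open>
  A short move from a point of the set towards a Slater point makes all constraints strict, and strict
  constraints survive small changes of the parameter. This is the lower semicontinuity of the
  feasible sets that their closed graph alone does not give.
\<close>

lemma strict_point_nearby:
  assumes h: "h \<in> K" and z: "z \<in> Q h" and e: "e > 0"
  obtains z' where "dist z' z < e" "\<forall>i\<in>I. g i h z' < 0"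
proof -
  obtain z0 where z0: "\<forall>i\<in>I. g i h z0 < 0" using slater[OF h] by blast
  have "((\<lambda>u. (1 - u) *\<^sub>R z + u *\<^sub>R z0) \<longlongrightarrow> (1 - 0) *\<^sub>R z + 0 *\<^sub>R z0) (at_right (0::real))"
    by (intro tendsto_intros)
  then have "eventually (\<lambda>u. dist ((1 - u) *\<^sub>R z + u *\<^sub>R z0) z < e) (at_right (0::real))"
    using e by (simp add: tendsto_iff)
  moreover have "eventually (\<lambda>u. 0 < u \<and> u < 1) (at_right (0::real))"
    by (auto simp: eventually_at_right_field intro: exI[of _ 1])
  ultimately have "eventually (\<lambda>u. dist ((1 - u) *\<^sub>R z + u *\<^sub>R z0) z < e \<and> 0 < u \<and> u < 1)
      (at_right (0::real))" by eventually_elim auto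
  then obtain u :: real where u: "dist ((1 - u) *\<^sub>R z + u *\<^sub>R z0) z < e" "0 < u" "u < 1"
    using eventually_happens[of _ "at_right (0::real)"] by auto
  have "g i h ((1 - u) *\<^sub>R z + u *\<^sub>R z0) < 0" if i: "i \<in> I" for i
  proof -
    have "g i h ((1 - u) *\<^sub>R z + u *\<^sub>R z0) \<le> (1 - u) * g i h z + u * g i h z0"
      using convex_onD[OF convex_g[OF i]] u by auto
    also have "\<dots> < 0" using z u i z0
      by (auto simp: sublevel_def intro!: add_nonpos_neg mult_nonneg_nonpos mult_pos_neg)
    finally show ?thesis .
  qed
  then show thesis using that u(1) by blast
qed

text \<open>
  The projections stay bounded, because feasible points near the limiting projection remain feasible
  for nearby parameters. A subsequential limit is feasible by the closed graph and at most as far away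
  as the limiting projection, hence equal to it.
\<close>

lemma tendsto_closest_point_Q:
  assumes hs: "hs \<longlonglongrightarrow> h" and xs: "xs \<longlonglongrightarrow> x" and h: "h \<in> K" and hsK: "\<And>n. hs n \<in> K"
  shows "(\<lambda>n. closest_point (Q (hs n)) (xs n)) \<longlonglongrightarrow> closest_point (Q h) x"
proof -
  define p where "p n = closest_point (Q (hs n)) (xs n)" for n
  define p0 where "p0 = closest_point (Q h) x"
  have pQ: "p n \<in> Q (hs n)" for n
    unfolding p_def by (intro closest_point_in_set closed_Q Q_nonempty hsK)
  have p0Q: "p0 \<in> Q h"
    unfolding p0_def by (intro closest_point_in_set closed_Q Q_nonempty h)
  have close: "eventually (\<lambda>n. dist (xs n) (p n) < dist x p0 + e) sequentially" if e: "e > 0" for e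
  proof -
    obtain z where z: "dist z p0 < e / 2" "\<forall>i\<in>I. g i h z < 0"
      using strict_point_nearby[OF h p0Q, of "e / 2"] e by auto
    have "eventually (\<lambda>n. g i (hs n) z < 0) sequentially" if "i \<in> I" for i
      using order_tendstoD(2)[OF tendsto_g[OF that hs tendsto_const]] z that by auto
    then have "eventually (\<lambda>n. \<forall>i\<in>I. g i (hs n) z < 0) sequentially"
      using finite_I by (simp add: eventually_ball_finite)
    moreover have "eventually (\<lambda>n. dist (xs n) x < e / 2) sequentially"
      using e by (intro tendstoD[OF xs]) simp
    ultimately show ?thesis
    proof eventually_elim
      case (elim n)
      have "z \<in> Q (hs n)" using elim(1) by (auto simp: sublevel_def intro: less_imp_le)
      then have "dist (xs n) (p n) \<le> dist (xs n) z"
        unfolding p_def by (intro closest_point_le closed_Q)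
      then show ?case using elim(2) z(1)
        using dist_triangle[of "xs n" z x] dist_triangle[of x z p0] by (simp add: dist_commute)
    qed
  qed
  show ?thesis
  proof (rule ccontr)
    assume "\<not> ?thesis"
    then obtain e where e: "e > 0" "\<not> eventually (\<lambda>n. dist (p n) p0 < e) sequentially"
      unfolding tendsto_iff p_def p0_def by blast
    obtain r where r: "strict_mono (r :: nat \<Rightarrow> nat)" "\<And>n. \<not> dist (p (r n)) p0 < e"
      using not_eventually_sequentiallyD[OF e(2)] by blast
    have "eventually (\<lambda>n. p n \<in> cball x (dist x p0 + 2)) sequentially"
      using close[OF zero_less_one] tendstoD[OF xs zero_less_one]
    proof eventually_elim
      case (elim n)
      then show ?case using dist_triangle[of x "p n" "xs n"] by (simp add: dist_commute)
    qed
    then have "eventually (\<lambda>n. p (r n) \<in> cball x (dist x p0 + 2)) sequentially"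
      by (rule eventually_compose_filterlim[OF _ filterlim_subseq[OF r(1)]])
    then obtain N where N: "\<And>n. n \<ge> N \<Longrightarrow> p (r n) \<in> cball x (dist x p0 + 2)"
      by (auto simp: eventually_sequentially)
    have "\<exists>l\<in>cball x (dist x p0 + 2). \<exists>s. strict_mono s \<and> ((\<lambda>n. p (r (n + N))) \<circ> s) \<longlonglongrightarrow> l"
      using compact_cball[of x "dist x p0 + 2"] N unfolding compact_def
      by (elim allE[of _ "\<lambda>n. p (r (n + N))"]) auto
    then obtain l s where s: "strict_mono (s :: nat \<Rightarrow> nat)" "((\<lambda>n. p (r (n + N))) \<circ> s) \<longlonglongrightarrow> l"
      by blast
    define q where "q n = r (s n + N)" for n
    have q: "strict_mono q"
      using s(1) r(1) by (auto simp: q_def strict_mono_def)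
    have pq: "(\<lambda>n. p (q n)) \<longlonglongrightarrow> l" using s(2) by (simp add: q_def o_def)
    have hq: "(\<lambda>n. hs (q n)) \<longlonglongrightarrow> h" and xq: "(\<lambda>n. xs (q n)) \<longlonglongrightarrow> x"
      using LIMSEQ_subseq_LIMSEQ[OF hs q] LIMSEQ_subseq_LIMSEQ[OF xs q] by (simp_all add: o_def)
    have lQ: "l \<in> Q h" using Q_limit[OF hq pq] pQ by blast
    have "dist x l \<le> dist x p0 + d" if "d > 0" for d
    proof (rule LIMSEQ_le_const2[OF tendsto_dist[OF xq pq]])
      have "eventually (\<lambda>n. dist (xs (q n)) (p (q n)) < dist x p0 + d) sequentially"
        by (rule eventually_compose_filterlim[OF close[OF that] filterlim_subseq[OF q]])
      then show "\<exists>N. \<forall>n\<ge>N. dist (xs (q n)) (p (q n)) \<le> dist x p0 + d"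
        by (auto simp: eventually_sequentially intro: less_imp_le)
    qed
    then have "dist x l \<le> dist x p0" by (rule field_le_epsilon)
    then have "l = p0"
      unfolding p0_def using closest_point_le[OF closed_Q, of _ h x]
      by (intro closest_point_unique convex_Q closed_Q lQ) (meson order_trans p0_def)
    moreover have "eventually (\<lambda>n. dist (p (q n)) l < e) sequentially"
      using pq e(1) by (simp add: tendsto_iff)
    then obtain n where "dist (p (q n)) l < e"
      using eventually_happens[of _ sequentially] by auto
    ultimately show False using r(2)[of "s n + N"] by (simp add: q_def)
  qed
qed

lemma continuous_on_closest_point_Q:
  "continuous_on (K \<times> UNIV) (\<lambda>(h, x). closest_point (Q h) x)"
  unfolding continuous_on_sequentially
proof (intro allI impI ballI)
  fix y and a :: "'h \<times> 'z" assume a: "a \<in> K \<times> UNIV" and y: "(\<forall>n. y n \<in> K \<times> UNIV) \<and> y \<longlonglongrightarrow> a"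
  have "(\<lambda>n. closest_point (Q (fst (y n))) (snd (y n))) \<longlonglongrightarrow> closest_point (Q (fst a)) (snd a)"
    using a y by (intro tendsto_closest_point_Q tendsto_fst tendsto_snd) (auto simp: mem_Times_iff)
  then show "((\<lambda>(h, x). closest_point (Q h) x) \<circ> y) \<longlonglongrightarrow> (\<lambda>(h, x). closest_point (Q h) x) a"
    by (simp add: o_def case_prod_unfold)
qed

end

section \<open>The partial inverse step\<close>

text \<open>
  The partial inverse method for a convex set \<open>S\<close> of pairs \<open>(w, t)\<close> and the subspace \<open>range P\<close>:
  \<open>prox\<close> minimizes \<open>\<parallel>w\<parallel>\<^sup>2 + \<parallel>t - u\<parallel>\<^sup>2\<close> over \<open>S\<close>, and \<open>step\<close> exchanges the components of \<open>t\<close>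
  and of the residual \<open>u - t\<close>, keeping that of \<open>t\<close> in the range of \<open>P\<close> and that of the residual in its
  complement.
\<close>

locale orthogonal_projection =
  fixes P :: "'c::euclidean_space \<Rightarrow> 'c"
  assumes linear_P: "linear P"
    and P_P: "\<And>x. P (P x) = P x"
    and P_selfadjoint: "\<And>x y. P x \<bullet> y = x \<bullet> P y"
begin

definition prox :: "('x::euclidean_space \<times> 'c) set \<Rightarrow> 'c \<Rightarrow> 'x \<times> 'c" where
  "prox S u = closest_point S (0, u)"

definition step :: "('x::euclidean_space \<times> 'c) set \<Rightarrow> 'c \<Rightarrow> 'c" where
  "step S u = P (snd (prox S u)) + (u - snd (prox S u)) - P (u - snd (prox S u))"

lemmas P_add = linear_add[OF linear_P] and P_diff = linear_diff[OF linear_P]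
  and P_0 = linear_0[OF linear_P]

lemma orthogonal_split:
  "(norm (P a + b - P b))\<^sup>2 = (norm (P a))\<^sup>2 + (norm (b - P b))\<^sup>2"
proof -
  have "P a \<bullet> (b - P b) = 0"
    by (simp add: inner_diff_right P_selfadjoint P_P)
  then have "(norm (P a + (b - P b)))\<^sup>2 = (norm (P a))\<^sup>2 + (norm (b - P b))\<^sup>2"
    by (intro norm_add_Pythagorean) (simp add: orthogonal_def)
  then show ?thesis by (simp add: add_diff_eq)
qed

lemma norm_split: "(norm b)\<^sup>2 = (norm (P b))\<^sup>2 + (norm (b - P b))\<^sup>2"
  using orthogonal_split[of b b] by simp

text \<open>
  Monotonicity of the projection onto \<open>S\<close> gives \<open>a \<bullet> b \<ge> \<parallel>\<Delta>w\<parallel>\<^sup>2\<close> for the differences \<open>a\<close> of the \<open>t\<close>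
  parts and \<open>b\<close> of the residuals. The first two terms on the left together are
  \<open>\<parallel>a\<parallel>\<^sup>2 + \<parallel>b\<parallel>\<^sup>2\<close>, as they regroup the orthogonal components of \<open>a\<close> and \<open>b\<close>.
\<close>

lemma step_firmly_nonexpansive:
  assumes "convex S" "closed S" "S \<noteq> {}"
  shows "(norm (step S u - step S v))\<^sup>2 + (norm ((u - step S u) - (v - step S v)))\<^sup>2
    + 2 * (norm (fst (prox S u) - fst (prox S v)))\<^sup>2 \<le> (norm (u - v))\<^sup>2"
proof -
  obtain w t where J: "prox S u = (w, t)" by (cases "prox S u")
  obtain w' t' where J': "prox S v = (w', t')" by (cases "prox S v")
  have mem: "(w, t) \<in> S" "(w', t') \<in> S"
    using closest_point_in_set[OF assms(2,3)] J J' by (auto simp: prox_def) metis+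
  have "((0, u) - (w, t)) \<bullet> ((w', t') - (w, t)) \<le> 0"
    using closest_point_dot[OF assms(1,2) mem(2), of "(0, u)"] J by (simp add: prox_def)
  moreover have "((0, v) - (w', t')) \<bullet> ((w, t) - (w', t')) \<le> 0"
    using closest_point_dot[OF assms(1,2) mem(1), of "(0, v)"] J' by (simp add: prox_def)
  ultimately have VI: "(norm (w - w'))\<^sup>2 \<le> (t - t') \<bullet> ((u - v) - (t - t'))"
    by (simp add: power2_norm_eq_inner algebra_simps inner_commute)
  define a where "a = t - t'"
  define b where "b = (u - v) - a"
  have 1: "step S u - step S v = P a + b - P b"
    by (simp add: step_def J J' a_def b_def P_diff P_add algebra_simps)
  have 2: "(u - step S u) - (v - step S v) = P b + a - P a"
    using 1 by (simp add: a_def b_def P_diff algebra_simps)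
  have "(norm (u - v))\<^sup>2 = (norm (a + b))\<^sup>2" by (simp add: a_def b_def)
  also have "\<dots> = (norm a)\<^sup>2 + (norm b)\<^sup>2 + 2 * (a \<bullet> b)"
    by (simp add: power2_norm_eq_inner algebra_simps inner_commute)
  also have "\<dots> = (norm (P a + b - P b))\<^sup>2 + (norm (P b + a - P a))\<^sup>2 + 2 * (a \<bullet> b)"
    unfolding orthogonal_split by (subst norm_split[of a], subst norm_split[of b]) simp
  finally show ?thesis unfolding 1 2 using VI by (simp add: J J' a_def b_def)
qed

lemma step_fixed_iff:
  "step S v = v \<longleftrightarrow> P (snd (prox S v)) = snd (prox S v) \<and> P (v - snd (prox S v)) = 0"
proof -
  define t where "t = snd (prox S v)"
  have "P t + (v - t) - P (v - t) = v \<longleftrightarrow> P t = t \<and> P (v - t) = 0"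
  proof
    assume *: "P t + (v - t) - P (v - t) = v"
    have "P (P t + (v - t) - P (v - t)) = P v" by (simp only: *)
    then have "P (v - t) = 0" by (simp add: P_add P_diff P_P)
    then show "P t = t \<and> P (v - t) = 0" using * by simp
  qed auto
  then show ?thesis by (simp add: step_def t_def)
qed

lemma prox_eqI:
  assumes "convex S" "closed S" "(w, t) \<in> S"
    and "\<And>w' t'. (w', t') \<in> S \<Longrightarrow> w \<bullet> (w' - w) \<ge> (u - t) \<bullet> (t' - t)"
  shows "prox S u = (w, t)"
proof -
  have "dist (0, u) (w, t) \<le> dist (0, u) z" if z: "z \<in> S" for z
  proof -
    obtain w' t' where zz: "z = (w', t')" by (cases z)
    have "(dist (0, u) z)\<^sup>2 = (dist (0, u) (w, t))\<^sup>2 + (norm (w' - w))\<^sup>2 + (norm (t' - t))\<^sup>2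
        + 2 * (w \<bullet> (w' - w) - (u - t) \<bullet> (t' - t))"
      by (simp add: zz dist_norm power2_norm_eq_inner inner_Pair algebra_simps inner_commute)
    also have "\<dots> \<ge> (dist (0, u) (w, t))\<^sup>2"
      using assms(4)[of w' t'] z zz by simp
    finally show ?thesis by (simp add: power2_le_iff_abs_le)
  qed
  then show ?thesis
    unfolding prox_def using closest_point_unique[OF assms(1,2,3)] by metis
qed

text \<open>
  Duality for minimizing \<open>\<parallel>w\<parallel>\<close> over the points of \<open>S\<close> with \<open>P t = t\<close>. The set \<open>A\<close> records by how
  much this consensus condition may be violated at which (linearized) cost; optimality separates it
  from the points without violation and with smaller cost. The Slater point makes the
  separating hyperplane non-vertical, and its slope is the price \<open>\<nu>\<close>.
\<close>

lemma multiplier_exists: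
  fixes S :: "('x::euclidean_space \<times> 'c) set"
  assumes S: "convex S" and mem: "(w, t) \<in> S" "P t = t"
    and opt: "\<And>w' t'. (w', t') \<in> S \<Longrightarrow> P t' = t' \<Longrightarrow> w \<bullet> (w' - w) \<ge> 0"
    and slater: "(w0, t0) \<in> interior S" "P t0 = t0"
  obtains \<nu> where "P \<nu> = 0" "\<And>w' t'. (w', t') \<in> S \<Longrightarrow> w \<bullet> (w' - w) \<ge> \<nu> \<bullet> (t' - t)"
proof -
  define A where "A = {(s, y). \<exists>w' t'. (w', t') \<in> S \<and> P (t' - s) = t' - s \<and> w \<bullet> (w' - w) \<le> (y::real)}"
  define B where "B = {0::'c} \<times> {..<0::real}"
  have "convex A"
    unfolding convex_alt
  proof safe
    fix s1 y1 s2 y2 and u :: real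
    assume "(s1, y1) \<in> A" "(s2, y2) \<in> A" and u: "0 \<le> u" "u \<le> 1"
    then obtain w1 t1 w2 t2 where 1: "(w1, t1) \<in> S" "P (t1 - s1) = t1 - s1" "w \<bullet> (w1 - w) \<le> y1"
      and 2: "(w2, t2) \<in> S" "P (t2 - s2) = t2 - s2" "w \<bullet> (w2 - w) \<le> y2"
      unfolding A_def by blast
    have "(1 - u) *\<^sub>R (w1, t1) + u *\<^sub>R (w2, t2) \<in> S"
      using S 1(1) 2(1) u unfolding convex_alt by blast
    moreover have "P (((1 - u) *\<^sub>R t1 + u *\<^sub>R t2) - ((1 - u) *\<^sub>R s1 + u *\<^sub>R s2))
        = ((1 - u) *\<^sub>R t1 + u *\<^sub>R t2) - ((1 - u) *\<^sub>R s1 + u *\<^sub>R s2)"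
    proof -
      have *: "((1 - u) *\<^sub>R t1 + u *\<^sub>R t2) - ((1 - u) *\<^sub>R s1 + u *\<^sub>R s2)
          = (1 - u) *\<^sub>R (t1 - s1) + u *\<^sub>R (t2 - s2)" by (simp add: algebra_simps)
      show ?thesis unfolding * by (simp only: P_add linear_scale[OF linear_P] 1 2)
    qed
    moreover have "w \<bullet> (((1 - u) *\<^sub>R w1 + u *\<^sub>R w2) - w)
        = (1 - u) * (w \<bullet> (w1 - w)) + u * (w \<bullet> (w2 - w))" by (simp add: algebra_simps)
    then have "w \<bullet> (((1 - u) *\<^sub>R w1 + u *\<^sub>R w2) - w) \<le> (1 - u) * y1 + u * y2"
      using 1(3) 2(3) u by (simp add: add_mono mult_left_mono)
    ultimately show "(1 - u) *\<^sub>R (s1, y1) + u *\<^sub>R (s2, y2) \<in> A"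
      unfolding A_def by (auto intro!: exI)
  qed
  moreover have "convex B" unfolding B_def by (intro convex_Times convex_singleton convex_real_interval)
  moreover have "(t, 0) \<in> A" unfolding A_def using mem(1)
    by (auto simp: P_0 intro!: exI[of _ w] exI[of _ t])
  then have "A \<noteq> {}" by blast
  moreover have "B \<noteq> {}" by (auto simp: B_def intro: exI[of _ "-1"])
  moreover have "B \<inter> A = {}" using opt by (fastforce simp: A_def B_def)
  ultimately obtain ab c where ab: "ab \<noteq> 0" "\<And>x. x \<in> B \<Longrightarrow> ab \<bullet> x \<le> c" "\<And>x. x \<in> A \<Longrightarrow> ab \<bullet> x \<ge> c"
    using separating_hyperplane_sets[of B A] by metis
  obtain a \<beta> where ab_eq: "ab = (a, \<beta>)" by (cases ab)
  have in_A: "a \<bullet> s + \<beta> * y \<ge> c" if "(w', t') \<in> S" "P (t' - s) = t' - s" "w \<bullet> (w' - w) \<le> y" for s y w' t'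
    using ab(3)[of "(s, y)"] that by (auto simp: A_def ab_eq)
  have \<beta>0: "\<beta> \<ge> 0"
  proof (rule ccontr)
    assume "\<not> \<beta> \<ge> 0"
    then have "a \<bullet> t + \<beta> * (max 0 ((c - a \<bullet> t - 1) / \<beta>)) < c"
      by (auto simp: max_def field_simps) 
    moreover have "a \<bullet> t + \<beta> * (max 0 ((c - a \<bullet> t - 1) / \<beta>)) \<ge> c"
      by (rule in_A[OF mem(1)]) (auto simp: P_0)
    ultimately show False by simp
  qed
  have c0: "c \<ge> 0"
  proof (rule field_le_epsilon)
    fix e :: real assume e: "e > 0"
    have "\<beta> * (- (e / (\<beta> + 1))) \<le> c"
      using ab(2)[of "(0, - (e / (\<beta> + 1)))"] e \<beta>0 by (simp add: B_def ab_eq)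
    moreover have "\<beta> * (e / (\<beta> + 1)) \<le> e" using \<beta>0 e by (simp add: field_simps)
    ultimately show "0 \<le> c + e" by simp
  qed
  have \<beta>: "\<beta> > 0"
  proof (rule ccontr)
    assume "\<not> \<beta> > 0"
    with \<beta>0 have b: "\<beta> = 0" by simp
    then have a: "a \<noteq> 0" using ab(1) ab_eq by (auto simp: zero_prod_def)
    obtain e where e: "e > 0" "ball (w0, t0) e \<subseteq> S" using slater(1) by (auto simp: mem_interior)
    \<comment> \<open>a vertical hyperplane would cut through the ball around the Slater point\<close>
    define s where "s = - (e / 2 / norm a) *\<^sub>R a"
    have "norm s < e" using e a by (simp add: s_def)
    then have "(w0, t0 + s) \<in> S" using e(2) by (auto simp: dist_norm norm_Pair)
    then have "a \<bullet> s + \<beta> * (w \<bullet> (w0 - w)) \<ge> c"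
      by (rule in_A) (auto simp: slater)
    then have "a \<bullet> s \<ge> 0" using b c0 by simp
    moreover have "a \<bullet> s < 0" using a e(1) by (simp add: s_def)
    ultimately show False by simp
  qed
  define \<nu> where "\<nu> = - (1 / \<beta>) *\<^sub>R a"
  have Pa: "P a = 0"
  proof (rule ccontr)
    assume "P a \<noteq> 0"
    then have pos: "a \<bullet> P a > 0" by (metis P_P P_selfadjoint inner_gt_zero_iff)
    define r where "r = (c - 1) / (a \<bullet> P a)"
    \<comment> \<open>the violation is only defined up to the range of P, so the slope vanishes there\<close>
    have "a \<bullet> (r *\<^sub>R P a) + \<beta> * 0 \<ge> c"
      by (rule in_A[OF mem(1)]) (simp_all add: P_diff mem linear_scale[OF linear_P] P_P)
    then show False using pos by (simp add: r_def)
  qed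
  show thesis
  proof (rule that)
    show "P \<nu> = 0" by (simp add: \<nu>_def linear_neg[OF linear_P] linear_scale[OF linear_P] Pa)
    fix w' t' assume "(w', t') \<in> S"
    then have "a \<bullet> (t' - t) + \<beta> * (w \<bullet> (w' - w)) \<ge> c"
      by (rule in_A) (auto simp: mem)
    then have "a \<bullet> (t' - t) + \<beta> * (w \<bullet> (w' - w)) \<ge> 0" using c0 by simp
    then show "w \<bullet> (w' - w) \<ge> \<nu> \<bullet> (t' - t)" using \<beta> by (simp add: \<nu>_def field_simps)
  qed
qed

end

section \<open>Tracking a moving fixed point\<close>

text \<open>
  On the sphere of radius \<open>r\<close> around \<open>v h\<close> the map \<open>T h\<close> brings points closer to \<open>v h\<close> by some
  \<open>q > 0\<close>, and so does \<open>T h'\<close>, with a smaller gain, for nearby \<open>h'\<close>. A fixed point \<open>v h'\<close> outside the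
  ball would then be closer to \<open>v h\<close> than it is, by the triangle inequality through the image of the
  point where the segment to \<open>v h\<close> meets the sphere.
\<close>

lemma fixed_points_move_continuously:
  fixes T :: "'h::metric_space \<Rightarrow> 'a::euclidean_space \<Rightarrow> 'a"
  assumes cont: "continuous_on (K \<times> UNIV) (\<lambda>(h, u). T h u)"
    and nonexp: "\<And>h u v. h \<in> K \<Longrightarrow> norm (T h u - T h v) \<le> norm (u - v)"
    and fixed: "\<And>h. h \<in> K \<Longrightarrow> T h (v h) = v h"
    and strict: "\<And>h u. h \<in> K \<Longrightarrow> u \<noteq> v h \<Longrightarrow> norm (T h u - v h) < norm (u - v h)"
    and K: "compact K"
  shows "continuous_on K v"
  unfolding continuous_on_iff
proof (intro ballI allI impI)
  fix h and r :: real assume h: "h \<in> K" and r: "r > 0"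
  have Th: "continuous_on A (T h)" for A
  proof -
    have "continuous_on A (\<lambda>u. (h, u))" by (intro continuous_intros)
    from continuous_on_compose2[OF cont this] h show ?thesis by auto
  qed
  obtain u0 where u0: "u0 \<in> sphere (v h) r" "\<And>u. u \<in> sphere (v h) r \<Longrightarrow>
      norm (T h u - v h) \<le> norm (T h u0 - v h)"
  proof -
    have "continuous_on (sphere (v h) r) (\<lambda>u. norm (T h u - v h))"
      by (intro continuous_intros Th)
    moreover have "sphere (v h) r \<noteq> {}" using r by simp
    ultimately have "\<exists>x\<in>sphere (v h) r. \<forall>y\<in>sphere (v h) r. norm (T h y - v h) \<le> norm (T h x - v h)"
      by (intro continuous_attains_sup compact_sphere)
    then show thesis using that by blast
  qed
  define q where "q = r - norm (T h u0 - v h)"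
  have q: "q > 0" using strict[OF h, of u0] u0(1) r by (auto simp: q_def dist_norm norm_minus_commute)
  have "uniformly_continuous_on (K \<times> sphere (v h) r) (\<lambda>(h, u). T h u)"
    by (intro compact_uniformly_continuous continuous_on_subset[OF cont] compact_Times K) auto
  then obtain d where d: "d > 0" "\<And>x y. x \<in> K \<times> sphere (v h) r \<Longrightarrow> y \<in> K \<times> sphere (v h) r \<Longrightarrow>
      dist y x < d \<Longrightarrow> dist (case_prod T y) (case_prod T x) < q"
    unfolding uniformly_continuous_on_def using q by metis
  show "\<exists>d>0. \<forall>h'\<in>K. dist h' h < d \<longrightarrow> dist (v h') (v h) < r"
  proof (intro exI conjI ballI impI)
    fix h' assume h': "h' \<in> K" "dist h' h < d"
    show "dist (v h') (v h) < r"
    proof (rule ccontr)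
      assume "\<not> dist (v h') (v h) < r"
      then have far: "norm (v h' - v h) \<ge> r" by (simp add: dist_norm)
      define n where "n = norm (v h' - v h)"
      have n: "n \<ge> r" "n > 0" using far r unfolding n_def by linarith+
      \<comment> \<open>the point where the segment from v h to v h' leaves the ball\<close>
      define u where "u = v h + (r / n) *\<^sub>R (v h' - v h)"
      have us: "u \<in> sphere (v h) r" using n r by (simp add: u_def dist_norm flip: n_def)
      have eq: "v h' - u = (1 - r / n) *\<^sub>R (v h' - v h)" by (simp add: u_def algebra_simps)
      have vu: "norm (v h' - u) = n - r"
        unfolding eq norm_scaleR n_def[symmetric] using n by (simp add: left_diff_distrib)
      have "norm (T h' u - T h u) < q"
        using d(2)[of "(h, u)" "(h', u)"] us h h' by (simp add: dist_norm norm_Pair dist_Pair_Pair)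
      then have "norm (T h' u - v h) < r"
        using u0(2)[OF us] norm_triangle_ineq[of "T h' u - T h u" "T h u - v h"] by (simp add: q_def)
      moreover have "norm (v h' - T h' u) \<le> n - r"
        using nonexp[OF h'(1), of "v h'" u] fixed[OF h'(1)] vu by simp
      ultimately show False
        using norm_triangle_ineq[of "v h' - T h' u" "T h' u - v h"] by (simp add: n_def)
    qed
  qed (rule d)
qed

text \<open>
  The minimal progress \<open>q\<close> on the sphere of radius \<open>R\<close> holds for all points outside it as well: such
  a point is moved by a nonexpansive map whose progress at the radial projection is at least \<open>q\<close>. The
  distance to the moving fixed point thus falls by at least \<open>q / 2\<close> per step until it is at most
  \<open>R + \<eta>\<close>. As the bound \<open>\<delta>\<close> is chosen before the sequences, it serves all starting points.
\<close>

lemma fixed_point_tracking: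
  fixes T :: "'h::metric_space \<Rightarrow> 'a::euclidean_space \<Rightarrow> 'a"
  assumes cont: "continuous_on (K \<times> UNIV) (\<lambda>(h, u). T h u)"
    and nonexp: "\<And>h u v. h \<in> K \<Longrightarrow> norm (T h u - T h v) \<le> norm (u - v)"
    and fixed: "\<And>h. h \<in> K \<Longrightarrow> T h (v h) = v h"
    and strict: "\<And>h u. h \<in> K \<Longrightarrow> u \<noteq> v h \<Longrightarrow> norm (T h u - v h) < norm (u - v h)"
    and K: "compact K" and r: "r > 0"
  shows "\<exists>\<delta>>0. \<forall>h u. (\<forall>i. h i \<in> K) \<longrightarrow> (\<forall>i. dist (h (Suc i)) (h i) \<le> \<delta>) \<longrightarrow>
           (\<forall>i. u (Suc i) = T (h (Suc i)) (u i)) \<longrightarrow>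
           eventually (\<lambda>i. norm (u i - v (h (Suc i))) \<le> r) sequentially"
proof (cases "K = {}")
  case True
  then show ?thesis by (auto intro: exI[of _ 1])
next
  case False
  define R where "R = r / 2"
  have R: "R > 0" using r by (simp add: R_def)
  have contv: "continuous_on K v"
    by (rule fixed_points_move_continuously[OF cont nonexp fixed strict K])
  define gap where "gap = (\<lambda>(h, d). R - norm (T h (v h + d) - v h))"
  have "continuous_on (K \<times> sphere 0 R) (\<lambda>x. T (fst x) (v (fst x) + snd x))"
  proof -
    have "continuous_on (K \<times> sphere 0 R) (\<lambda>x. (fst x, v (fst x) + snd x))"
      by (auto intro!: continuous_intros continuous_on_compose2[OF contv])
    from continuous_on_compose2[OF cont this] show ?thesis by (simp add: image_subset_iff mem_Times_iff)
  qed
  then have "continuous_on (K \<times> sphere 0 R) gap"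
    unfolding gap_def case_prod_unfold
    by (auto intro!: continuous_intros continuous_on_compose2[OF contv])
  moreover have "K \<times> sphere (0::'a) R \<noteq> {}" using False R by auto
  ultimately have "\<exists>x\<in>K \<times> sphere 0 R. \<forall>y\<in>K \<times> sphere 0 R. gap x \<le> gap y"
    by (intro continuous_attains_inf compact_Times K compact_sphere)
  then obtain x0 where x0: "x0 \<in> K \<times> sphere 0 R" "\<And>x. x \<in> K \<times> sphere 0 R \<Longrightarrow> gap x0 \<le> gap x"
    by blast
  define q where "q = gap x0"
  have "gap x0 > 0"
    using x0(1) strict[of "fst x0" "v (fst x0) + snd x0"] R
    by (auto simp: gap_def case_prod_unfold mem_Times_iff)
  then have q: "q > 0" by (simp add: q_def)
  have progress: "norm (T h u - v h) \<le> norm (u - v h) - q" if h: "h \<in> K" and u: "norm (u - v h) \<ge> R" for h u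
  proof -
    define n where "n = norm (u - v h)"
    have n: "n \<ge> R" "n > 0" using u R unfolding n_def by linarith+
    define d where "d = (R / n) *\<^sub>R (u - v h)"
    have nd: "norm d = R" using n R by (simp add: d_def flip: n_def)
    then have "(h, d) \<in> K \<times> sphere 0 R" using h by simp
    from x0(2)[OF this] have 1: "norm (T h (v h + d) - v h) \<le> R - q" by (simp add: gap_def q_def)
    have eq: "u - (v h + d) = (1 - R / n) *\<^sub>R (u - v h)" by (simp add: d_def algebra_simps)
    have "norm (u - (v h + d)) = n - R"
      unfolding eq norm_scaleR n_def[symmetric] using n by (simp add: left_diff_distrib)
    then have "norm (T h u - T h (v h + d)) \<le> n - R" using nonexp[OF h] by metis
    then show ?thesis
      using 1 norm_triangle_ineq[of "T h u - T h (v h + d)" "T h (v h + d) - v h"] by (simp add: n_def)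
  qed
  define \<eta> where "\<eta> = min (q / 2) R"
  have \<eta>: "\<eta> > 0" "\<eta> \<le> q / 2" "\<eta> \<le> R" using q R by (auto simp: \<eta>_def)
  have "uniformly_continuous_on K v" by (rule compact_uniformly_continuous[OF contv K])
  then obtain d where d: "d > 0" "\<And>h h'. h \<in> K \<Longrightarrow> h' \<in> K \<Longrightarrow> dist h' h < d \<Longrightarrow> dist (v h') (v h) < \<eta>"
    unfolding uniformly_continuous_on_def using \<eta>(1) by metis
  show ?thesis
  proof (intro exI[of _ "d / 2"] conjI allI impI)
    show "d / 2 > 0" using d(1) by simp
    fix h u assume hK: "\<forall>i. h i \<in> K" and slow: "\<forall>i. dist (h (Suc i)) (h i) \<le> d / 2"
      and u: "\<forall>i. u (Suc i) = T (h (Suc i)) (u i)"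
    define a where "a i = norm (u i - v (h (Suc i)))" for i
    have move: "norm (v (h (Suc (Suc i))) - v (h (Suc i))) < \<eta>" for i
      using d(2)[of "h (Suc i)" "h (Suc (Suc i))"] hK slow[rule_format, of "Suc i"] d(1)
      by (simp add: dist_norm)
    have step: "a (Suc i) \<le> max (a i - q / 2) (R + \<eta>)" for i
    proof -
      have "norm (u (Suc i) - v (h (Suc i))) \<le> max (a i - q) R"
      proof (cases "a i \<ge> R")
        case True
        then show ?thesis using progress[of "h (Suc i)" "u i"] hK u by (auto simp: a_def)
      next
        case False
        then show ?thesis using nonexp[of "h (Suc i)" "u i" "v (h (Suc i))"] fixed[of "h (Suc i)"] hK u
          by (auto simp: a_def)
      qed
      moreover have "a (Suc i) \<le> norm (u (Suc i) - v (h (Suc i))) + norm (v (h (Suc i)) - v (h (Suc (Suc i))))"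
        unfolding a_def using norm_triangle_ineq[of "u (Suc i) - v (h (Suc i))" "v (h (Suc i)) - v (h (Suc (Suc i)))"] by simp
      ultimately show ?thesis using move[of i] \<eta> by (auto simp: norm_minus_commute max_def split: if_splits)
    qed
    have bound: "a i \<le> max (a 0 - real i * (q / 2)) (R + \<eta>)" for i
    proof (induction i)
      case (Suc i)
      have "real (Suc i) * (q / 2) = real i * (q / 2) + q / 2" by (simp add: field_simps)
      with Suc show ?case using step[of i] q by linarith
    qed simp
    obtain N where N: "a 0 \<le> real N * (q / 2)"
      using reals_Archimedean3[of "q / 2"] q by (metis half_gt_zero less_imp_le)
    have "a i \<le> r" if "i \<ge> N" for i
    proof -
      have "real N * (q / 2) \<le> real i * (q / 2)" using that q by simp
      then have "max (a 0 - real i * (q / 2)) (R + \<eta>) \<le> R + \<eta>" using N \<eta> R by linarith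
      then show ?thesis using bound[of i] \<eta>(3) by (simp add: R_def)
    qed
    then show "eventually (\<lambda>i. norm (u i - v (h (Suc i))) \<le> r) sequentially"
      unfolding a_def eventually_sequentially by blast
  qed
qed

section \<open>Beam-forming constraints as second-order cones\<close>

definition gain :: "('k::finite \<Rightarrow> 'b::finite) \<Rightarrow> ('n::finite, 'k, 'b) channels \<Rightarrow> ('n, 'k) beams \<Rightarrow> 'k \<Rightarrow> 'k \<Rightarrow> real" where
  "gain bs H W i k = (cmod (hdot (H $ bs i $ k) (W $ i)))\<^sup>2"

lemma hdot_add: "hdot h (v + w) = hdot h v + hdot h w"
  by (simp add: hdot_def algebra_simps sum.distrib)

lemma hdot_scaleR: "hdot h (c *\<^sub>R w) = c *\<^sub>R hdot h w"
  by (simp add: hdot_def scaleR_sum_right)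

lemma hdot_mult: "hdot h (c *s w) = c * hdot h w"
  by (simp add: hdot_def sum_distrib_left algebra_simps)

lemma continuous_on_hdot [continuous_intros]:
  assumes "continuous_on S f" "continuous_on S g"
  shows "continuous_on S (\<lambda>x. hdot (f x) (g x))"
  unfolding hdot_def by (intro continuous_intros assms)

lemma continuous_on_if_const:
  assumes "c \<Longrightarrow> continuous_on S f" "\<not> c \<Longrightarrow> continuous_on S g"
  shows "continuous_on S (\<lambda>x. if c then f x else g x)"
  using assms by (cases c) simp_all

lemma norm_vec_sq: "(norm (v :: 'a::real_normed_vector ^ 'm::finite))\<^sup>2 = (\<Sum>i\<in>UNIV. (norm (v $ i))\<^sup>2)"
  by (simp add: norm_vec_def L2_set_def sum_nonneg)

lemma sum_masked: "(\<Sum>i\<in>(UNIV::'a::finite set). if P i then f i else 0) = sum f {i. P i}"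
  by (simp add: sum.If_cases)

text \<open>
  For a real nonnegative product of channel and beam-former, a lower bound on an SINR is a cone
  constraint, because then the modulus equals the real part. Without a condition on the phase only the
  implication from the cone to the ratio remains.
\<close>

lemma cone_imp_ratio:
  assumes "sqrt g * x \<le> Re z" "g > 0" "x > 0" shows "g \<le> (cmod z)\<^sup>2 / x\<^sup>2"
proof -
  have "(sqrt g * x)\<^sup>2 \<le> (cmod z)\<^sup>2"
    using assms complex_Re_le_cmod[of z] by (intro power_mono) auto
  then show ?thesis using assms by (simp add: power_mult_distrib pos_le_divide_eq)
qed

lemma ratio_imp_cone:
  assumes "g \<le> (cmod z)\<^sup>2 / x\<^sup>2" "g > 0" "x > 0" "z \<in> \<real>" "Re z \<ge> 0" shows "sqrt g * x \<le> Re z"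
proof -
  have "cmod z = Re z" using assms by (simp add: in_Reals_norm)
  then have "(sqrt g * x)\<^sup>2 \<le> (Re z)\<^sup>2"
    using assms by (simp add: power_mult_distrib pos_le_divide_eq)
  then show ?thesis using assms(5) by (rule power2_le_imp_le)
qed

lemma ratio_imp_cone_strict:
  assumes "g < (cmod z)\<^sup>2 / x\<^sup>2" "g > 0" "x > 0" "z \<in> \<real>" "Re z \<ge> 0" shows "sqrt g * x < Re z"
proof -
  have "cmod z = Re z" using assms by (simp add: in_Reals_norm)
  then have "(sqrt g * x)\<^sup>2 < (Re z)\<^sup>2"
    using assms by (simp add: power_mult_distrib pos_less_divide_eq)
  then show ?thesis using assms(5) by (rule power2_less_imp_less)
qed

lemma convex_on_norm_affine:
  fixes f :: "'a::real_vector \<Rightarrow> 'c::real_normed_vector"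
  assumes "\<And>x y u. f ((1 - u) *\<^sub>R x + u *\<^sub>R y) = (1 - u) *\<^sub>R f x + u *\<^sub>R f y"
  shows "convex_on UNIV (\<lambda>x. norm (f x))"
proof (rule convex_onI)
  fix u x y assume "0 < (u::real)" "u < 1"
  then show "norm (f ((1 - u) *\<^sub>R x + u *\<^sub>R y)) \<le> (1 - u) * norm (f x) + u * norm (f y)"
    unfolding assms by (intro order_trans[OF norm_triangle_ineq]) simp
qed simp

lemma convex_on_diff_affine:
  fixes f g :: "'a::real_vector \<Rightarrow> real"
  assumes "convex_on UNIV f" "\<And>x y u. g ((1 - u) *\<^sub>R x + u *\<^sub>R y) = (1 - u) * g x + u * g y"
  shows "convex_on UNIV (\<lambda>x. f x - g x)"
proof (rule convex_onI)
  fix u x y assume "0 < (u::real)" "u < 1"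
  then show "f ((1 - u) *\<^sub>R x + u *\<^sub>R y) - g ((1 - u) *\<^sub>R x + u *\<^sub>R y)
      \<le> (1 - u) * (f x - g x) + u * (f y - g y)"
    unfolding assms(2) using convex_onD[OF assms(1), of u x y] by (simp add: algebra_simps)
qed simp

text \<open>
  Copies are measured in multiples of \<open>\<kappa>\<close>. The value \<open>\<kappa> = sqrt (2 / \<rho>)\<close> gives the penalty term
  weight one, which makes the local minimization a Euclidean projection.
\<close>

locale network =
  fixes bs :: "'k::finite \<Rightarrow> 'b::finite" and \<sigma> \<gamma> :: "'k \<Rightarrow> real" and \<kappa> :: real
  assumes noise_pos: "\<And>k. \<sigma> k > 0" and target_pos: "\<And>k. \<gamma> k > 0" and unit_pos: "\<kappa> > 0"
begin

definition signal :: "('n::finite, 'k, 'b) channels \<Rightarrow> ('n, 'k) beams \<Rightarrow> 'k \<Rightarrow> real" where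
  "signal H W k = Re (hdot (H $ bs k $ k) (W $ k))"

definition leak :: "('n::finite, 'k, 'b) channels \<Rightarrow> ('n, 'k) beams \<Rightarrow> 'b \<Rightarrow> 'k \<Rightarrow> complex ^ 'k" where
  "leak H W m k = (\<chi> i. if bs i = m then hdot (H $ m $ k) (W $ i) else 0)"

text \<open>
  The norm of this vector is the square root of the denominator of the local SINR, and it is a convex
  function of the beam-formers and copies because the vector depends on them affinely.
\<close>

definition local_load ::
  "('n::finite, 'k, 'b) channels \<Rightarrow> ('n, 'k) beams \<times> ('k, 'b) copies \<Rightarrow> 'k \<Rightarrow> (complex ^ 'k) \<times> (real ^ 'b) \<times> real"
where
  "local_load H z k =
     ((\<chi> i. if bs i = bs k \<and> i \<noteq> k then hdot (H $ bs k $ k) (fst z $ i) else 0),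
      (\<chi> m. if m \<noteq> bs k then \<kappa> * snd z $ (bs k, m, k) else 0), \<sigma> k)"

definition load :: "('n::finite, 'k, 'b) channels \<Rightarrow> ('n, 'k) beams \<Rightarrow> 'k \<Rightarrow> (complex ^ 'k) \<times> real" where
  "load H W k = ((\<chi> i. if i \<noteq> k then hdot (H $ bs i $ k) (W $ i) else 0), \<sigma> k)"

text \<open>
  The pairs \<open>(b, j)\<close> with \<open>bs j = b\<close> carry no constraint; the value \<open>-1\<close> makes them strictly
  satisfied everywhere.
\<close>

fun local_constraint ::
  "'k + 'b \<times> 'k \<Rightarrow> ('n::finite, 'k, 'b) channels \<Rightarrow> ('n, 'k) beams \<times> ('k, 'b) copies \<Rightarrow> real"
where
  "local_constraint (Inl k) H z = sqrt (\<gamma> k) * norm (local_load H z k) - signal H (fst z) k"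
| "local_constraint (Inr (b, j)) H z =
     (if bs j = b then -1 else norm (leak H (fst z) b j) - \<kappa> * snd z $ (b, b, j))"

definition central_constraint ::
  "'k \<Rightarrow> ('n::finite, 'k, 'b) channels \<Rightarrow> ('n, 'k) beams \<Rightarrow> real"
where
  "central_constraint k H W = sqrt (\<gamma> k) * norm (load H W k) - signal H W k"

lemma norm_leak: "(norm (leak H W m k))\<^sup>2 = (\<Sum>i\<in>users bs m. gain bs H W i k)"
proof -
  have "(norm (leak H W m k))\<^sup>2 = (\<Sum>i\<in>UNIV. if bs i = m then gain bs H W i k else 0)"
    unfolding norm_vec_sq by (rule sum.cong) (auto simp: leak_def gain_def)
  then show ?thesis by (simp add: sum_masked users_def)
qed

lemma norm_local_load:
  "(norm (local_load H (W, t) k))\<^sup>2 = (\<Sum>i\<in>users bs (bs k) - {k}. gain bs H W i k)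
     + (\<Sum>m\<in>UNIV - {bs k}. (\<kappa> * t $ (bs k, m, k))\<^sup>2) + (\<sigma> k)\<^sup>2"
proof -
  have "(\<Sum>i\<in>UNIV. (norm (fst (local_load H (W, t) k) $ i))\<^sup>2) = (\<Sum>i\<in>UNIV. if bs i = bs k \<and> i \<noteq> k then gain bs H W i k else 0)"
    by (rule sum.cong) (auto simp: local_load_def gain_def)
  moreover have "{i. bs i = bs k \<and> i \<noteq> k} = users bs (bs k) - {k}" by (auto simp: users_def)
  moreover have "(\<Sum>m\<in>UNIV. (norm (fst (snd (local_load H (W, t) k)) $ m))\<^sup>2)
      = (\<Sum>m\<in>UNIV. if m \<noteq> bs k then (\<kappa> * t $ (bs k, m, k))\<^sup>2 else 0)"
    by (rule sum.cong) (auto simp: local_load_def power2_eq_square)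
  moreover have "{m. m \<noteq> bs k} = UNIV - {bs k}" by auto
  moreover have "(norm x)\<^sup>2 = (norm (fst x))\<^sup>2 + ((norm (fst (snd x)))\<^sup>2 + (norm (snd (snd x)))\<^sup>2)"
    for x :: "(complex ^ 'k) \<times> (real ^ 'b) \<times> real"
    by (cases x) (simp add: norm_Pair)
  ultimately show ?thesis by (simp add: norm_vec_sq sum_masked) (simp add: local_load_def)
qed

lemma norm_load: "(norm (load H W k))\<^sup>2 = (\<Sum>i\<in>UNIV - {k}. gain bs H W i k) + (\<sigma> k)\<^sup>2"
proof -
  have "(\<Sum>i\<in>UNIV. (norm (fst (load H W k) $ i))\<^sup>2) = (\<Sum>i\<in>UNIV. if i \<noteq> k then gain bs H W i k else 0)"
    by (rule sum.cong) (auto simp: load_def gain_def)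
  moreover have "{i. i \<noteq> k} = UNIV - {k}" by auto
  moreover have "(norm x)\<^sup>2 = (norm (fst x))\<^sup>2 + (norm (snd x))\<^sup>2" for x :: "(complex ^ 'k) \<times> real"
    by (cases x) (simp add: norm_Pair)
  ultimately show ?thesis by (simp add: norm_vec_sq sum_masked) (simp add: load_def)
qed

lemma sum_other_users:
  "(\<Sum>i\<in>UNIV - {k}. f i) = (\<Sum>i\<in>users bs (bs k) - {k}. f i) + (\<Sum>m\<in>UNIV - {bs k}. \<Sum>i\<in>users bs m. f i :: real)"
proof -
  have "(\<Sum>m\<in>UNIV - {bs k}. \<Sum>i\<in>users bs m. f i) = (\<Sum>m\<in>UNIV - {bs k}. sum f {i \<in> {i. bs i \<noteq> bs k}. bs i = m})"
    by (rule sum.cong) (auto simp: users_def intro!: sum.cong)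
  also have "\<dots> = sum f {i. bs i \<noteq> bs k}"
    by (rule sum.group) auto
  finally have 1: "(\<Sum>m\<in>UNIV - {bs k}. \<Sum>i\<in>users bs m. f i) = sum f {i. bs i \<noteq> bs k}" .
  have "UNIV - {k} = (users bs (bs k) - {k}) \<union> {i. bs i \<noteq> bs k}" by (auto simp: users_def)
  then show ?thesis unfolding 1
    by (simp add: sum.union_disjoint users_def disjoint_iff)
qed

lemma norm_load_split:
  "(norm (load H W k))\<^sup>2 = (\<Sum>i\<in>users bs (bs k) - {k}. gain bs H W i k)
     + (\<Sum>m\<in>UNIV - {bs k}. (norm (leak H W m k))\<^sup>2) + (\<sigma> k)\<^sup>2"
  unfolding norm_load norm_leak sum_other_users ..

lemma load_pos: "norm (load H W k) > 0" and local_load_pos: "norm (local_load H z k) > 0"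
  using noise_pos[of k] by (auto simp: load_def local_load_def zero_prod_def)

lemma sinr_eq: "sinr bs \<sigma> H W k = (cmod (hdot (H $ bs k $ k) (W $ k)))\<^sup>2 / (norm (load H W k))\<^sup>2"
proof -
  have "(\<Sum>m\<in>UNIV - {bs k}. \<Sum>i\<in>users bs m. (cmod (hdot (H $ m $ k) (W $ i)))\<^sup>2)
    = (\<Sum>m\<in>UNIV - {bs k}. \<Sum>i\<in>users bs m. gain bs H W i k)"
    by (intro sum.cong refl) (auto simp: gain_def users_def)
  moreover have "(\<Sum>i\<in>users bs (bs k) - {k}. (cmod (hdot (H $ bs k $ k) (W $ i)))\<^sup>2)
    = (\<Sum>i\<in>users bs (bs k) - {k}. gain bs H W i k)"
    by (intro sum.cong refl) (auto simp: gain_def users_def)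
  ultimately show ?thesis by (simp add: sinr_def norm_load sum_other_users)
qed

lemma local_sinr_eq:
  "local_sinr bs \<sigma> H W (\<kappa> *\<^sub>R t) k = (cmod (hdot (H $ bs k $ k) (W $ k)))\<^sup>2 / (norm (local_load H (W, t) k))\<^sup>2"
proof -
  have "(\<Sum>i\<in>users bs (bs k) - {k}. (cmod (hdot (H $ bs k $ k) (W $ i)))\<^sup>2)
    = (\<Sum>i\<in>users bs (bs k) - {k}. gain bs H W i k)"
    by (intro sum.cong refl) (auto simp: gain_def users_def)
  then show ?thesis by (simp add: local_sinr_def norm_local_load)
qed

lemma continuous_local_constraint:
  "continuous_on UNIV (\<lambda>(H :: ('n::finite, 'k, 'b) channels, z). local_constraint i H z)"
proof -
  have "continuous_on UNIV (\<lambda>x :: ('n, 'k, 'b) channels \<times> _. local_load (fst x) (snd x) k)" for k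
    unfolding local_load_def
    by (intro continuous_intros continuous_on_vec_lambda continuous_on_if_const)
  moreover have "continuous_on UNIV (\<lambda>x :: ('n, 'k, 'b) channels \<times> (('n, 'k) beams \<times> ('k, 'b) copies). leak (fst x) (fst (snd x)) b k)" for b k
    unfolding leak_def
    by (intro continuous_intros continuous_on_vec_lambda continuous_on_if_const)
  ultimately show ?thesis
    by (cases i rule: sum.exhaust[case_names Inl Inr])
      (auto simp: case_prod_unfold signal_def intro!: continuous_intros continuous_on_if_const)
qed

lemma continuous_central_constraint:
  "continuous_on UNIV (\<lambda>(H :: ('n::finite, 'k, 'b) channels, W). central_constraint k H W)"
proof -
  have "continuous_on UNIV (\<lambda>x :: ('n, 'k, 'b) channels \<times> _. load (fst x) (snd x) k)"
    unfolding load_def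
    by (intro continuous_intros continuous_on_vec_lambda continuous_on_if_const)
  then show ?thesis
    by (auto simp: case_prod_unfold signal_def central_constraint_def intro!: continuous_intros)
qed

lemma affine_load:
  "load H ((1 - u) *\<^sub>R x + u *\<^sub>R y) k = (1 - u) *\<^sub>R load H x k + u *\<^sub>R load H y k"
  by (simp add: load_def vec_eq_iff hdot_add hdot_scaleR) (simp add: algebra_simps)

lemma affine_local_load:
  "local_load H ((1 - u) *\<^sub>R x + u *\<^sub>R y) k = (1 - u) *\<^sub>R local_load H x k + u *\<^sub>R local_load H y k"
  by (simp add: local_load_def vec_eq_iff hdot_add hdot_scaleR) (simp add: algebra_simps)

lemma affine_leak:
  "leak H ((1 - u) *\<^sub>R x + u *\<^sub>R y) b k = (1 - u) *\<^sub>R leak H x b k + u *\<^sub>R leak H y b k"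
  by (simp add: leak_def vec_eq_iff hdot_add hdot_scaleR)

lemma affine_signal:
  "signal H ((1 - u) *\<^sub>R x + u *\<^sub>R y) k = (1 - u) * signal H x k + u * signal H y k"
  by (simp add: signal_def hdot_add hdot_scaleR)

lemma convex_central_constraint: "convex_on UNIV (central_constraint k H)"
  unfolding central_constraint_def
  by (intro convex_on_diff_affine convex_on_cmul convex_on_norm_affine affine_load affine_signal)
    (simp add: target_pos less_imp_le)

lemma convex_local_constraint: "convex_on UNIV (local_constraint i H)"
proof (cases i rule: sum.exhaust[case_names Inl Inr])
  case (Inl k)
  have "convex_on UNIV (\<lambda>z. sqrt (\<gamma> k) * norm (local_load H z k) - signal H (fst z) k)"
    by (intro convex_on_diff_affine convex_on_cmul convex_on_norm_affine affine_local_load)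
      (simp_all add: target_pos less_imp_le affine_signal)
  moreover have "local_constraint (Inl k) H = (\<lambda>z. sqrt (\<gamma> k) * norm (local_load H z k) - signal H (fst z) k)"
    by (rule ext) simp
  ultimately show ?thesis by (simp add: Inl)
next
  case (Inr bj)
  obtain b j where bj: "bj = (b, j)" by (cases bj)
  have "convex_on UNIV (\<lambda>z. norm (leak H (fst z) b j) - \<kappa> * snd z $ (b, b, j))"
    by (intro convex_on_diff_affine convex_on_norm_affine) (simp_all add: affine_leak distrib_left)
  moreover have "local_constraint (Inr (b, j)) H
      = (if bs j = b then (\<lambda>_. -1) else (\<lambda>z. norm (leak H (fst z) b j) - \<kappa> * snd z $ (b, b, j)))"
    by (rule ext) simp
  ultimately show ?thesis by (simp add: Inr bj convex_on_const)
qed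

end

section \<open>The averaging projection\<close>

text \<open>
  The coordinates of the copies that are held by some base station; \<open>consensus\<close> vanishes on the
  others.
\<close>

definition linked :: "('k \<Rightarrow> 'b) \<Rightarrow> 'b \<times> 'b \<times> 'k \<Rightarrow> bool" where
  "linked bs = (\<lambda>(l, m, k). m \<noteq> bs k \<and> (l = m \<or> l = bs k))"

definition consensus :: "('k::finite \<Rightarrow> 'b::finite) \<Rightarrow> ('k, 'b) copies \<Rightarrow> ('k, 'b) copies" where
  "consensus bs t = copy_matrix bs *v (pinv (copy_matrix bs) *v t)"

lemma consensus_component:
  "consensus bs t $ (l, m, k) =
     (if m \<noteq> bs k \<and> (l = m \<or> l = bs k) then (t $ (m, m, k) + t $ (bs k, m, k)) / 2 else 0)"
  by (simp add: consensus_def copy_matrix_mult pinv_copy_matrix_mult)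

lemma consensus_alt:
  "consensus bs t = (1/2) *\<^sub>R (copy_matrix bs *v (transpose (copy_matrix bs) *v t))"
  by (simp add: consensus_def pinv_copy_matrix scaleR_matrix_vector_assoc[symmetric]
      matrix_vector_mult_scaleR del: transpose_matrix_vector)

lemma consensus_fixed_iff:
  "consensus bs t = t \<longleftrightarrow> (\<forall>l m k. if m \<noteq> bs k \<and> (l = m \<or> l = bs k)
     then t $ (m, m, k) = t $ (bs k, m, k) else t $ (l, m, k) = 0)"
  by (force simp: vec_eq_iff consensus_component split: if_splits)

lemma consensus_zero_iff:
  "consensus bs t = 0 \<longleftrightarrow> (\<forall>m k. m \<noteq> bs k \<longrightarrow> t $ (m, m, k) = - t $ (bs k, m, k))"
  by (auto simp: vec_eq_iff consensus_component eq_neg_iff_add_eq_0 split: if_splits)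

lemma orthogonal_projection_consensus: "orthogonal_projection (consensus bs)"
proof (rule orthogonal_projection.intro)
  show "linear (consensus bs)"
    unfolding consensus_def
    by (rule linearI) (simp_all add: matrix_vector_right_distrib matrix_vector_mult_scaleR)
  show "consensus bs (consensus bs x) = consensus bs x" for x :: "('b, 'a) copies"
    by (auto simp: vec_eq_iff consensus_component)
  have *: "consensus bs x \<bullet> y = (1/2) * ((transpose (copy_matrix bs) *v x) \<bullet> (transpose (copy_matrix bs) *v y))"
    for x y :: "('b, 'a) copies"
    unfolding consensus_alt using dot_lmul_matrix[of y "copy_matrix bs" "x v* copy_matrix bs"]
    by (simp add: inner_commute)
  show "consensus bs x \<bullet> y = x \<bullet> consensus bs y" for x y :: "('b, 'a) copies"
    unfolding inner_commute[of x "consensus bs y"] * by (simp only: inner_commute)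
qed

section \<open>The centralized optimum\<close>

context network
begin

text \<open>
  For \<open>e = 0\<close> these are the interference amplitudes that the beam-formers actually cause, in units of
  \<open>\<kappa>\<close>. A positive \<open>e\<close> adds the slack that a Slater point needs in the interference constraints.
\<close>

definition leak_copies :: "real \<Rightarrow> ('n::finite, 'k, 'b) channels \<Rightarrow> ('n, 'k) beams \<Rightarrow> ('k, 'b) copies" where
  "leak_copies e H W = (\<chi> c. if linked bs c
     then (case c of (l, m, k) \<Rightarrow> sqrt ((norm (leak H W m k))\<^sup>2 + e) / \<kappa>) else 0)"

abbreviation local_set :: "('n::finite, 'k, 'b) channels \<Rightarrow> (('n, 'k) beams \<times> ('k, 'b) copies) set" where
  "local_set \<equiv> sublevel local_constraint UNIV"

abbreviation central_set :: "('n::finite, 'k, 'b) channels \<Rightarrow> ('n, 'k) beams set" where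
  "central_set \<equiv> sublevel central_constraint UNIV"

lemma leak_copies_nth:
  "leak_copies e H W $ (l, m, k) =
     (if m \<noteq> bs k \<and> (l = m \<or> l = bs k) then sqrt ((norm (leak H W m k))\<^sup>2 + e) / \<kappa> else 0)"
  by (simp add: leak_copies_def linked_def)

lemma consensus_leak_copies: "consensus bs (leak_copies e H W) = leak_copies e H W"
  by (auto simp: consensus_fixed_iff leak_copies_nth)

lemma norm_local_load_leak_copies:
  assumes "e \<ge> 0"
  shows "(norm (local_load H (W, leak_copies e H W) k))\<^sup>2
    = (norm (load H W k))\<^sup>2 + real (card (UNIV - {bs k})) * e"
proof -
  have "(\<Sum>m\<in>UNIV - {bs k}. (\<kappa> * leak_copies e H W $ (bs k, m, k))\<^sup>2)
      = (\<Sum>m\<in>UNIV - {bs k}. (norm (leak H W m k))\<^sup>2 + e)"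
    using assms unit_pos by (intro sum.cong refl) (auto simp: leak_copies_nth)
  then show ?thesis by (simp add: norm_local_load norm_load_split sum.distrib)
qed

text \<open>
  Rotating each beam-former so that its own product with the channel is real and positive changes no
  modulus, hence no SINR, and turns the strict SINR constraints into strict cone constraints.
\<close>

lemma strictly_feasible_central:
  assumes "strictly_feasible bs \<sigma> \<gamma> H"
  obtains W where "\<And>k. central_constraint k H W < 0"
proof -
  obtain V where V: "\<And>k. sinr bs \<sigma> H V k > \<gamma> k"
    using assms unfolding strictly_feasible_def by blast
  define z where "z k = hdot (H $ bs k $ k) (V $ k)" for k
  define W where "W = (\<chi> k. (cnj (z k) / cmod (z k)) *s V $ k)"
  have z0: "z k \<noteq> 0" for k
    using V[of k] target_pos[of k] by (auto simp: sinr_eq z_def)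
  have Wz: "hdot (H $ bs k $ k) (W $ k) = cmod (z k)" for k
    using z0[of k] complex_norm_square[of "z k"]
    by (simp add: W_def hdot_mult z_def[symmetric] field_simps power2_eq_square)
  have "gain bs H W i k = gain bs H V i k" for i k
    using z0[of i] by (simp add: gain_def W_def hdot_mult norm_mult norm_divide)
  then have "(norm (load H W k))\<^sup>2 = (norm (load H V k))\<^sup>2" for k
    by (simp add: norm_load)
  then have "sinr bs \<sigma> H W k > \<gamma> k" for k
    using V[of k] by (simp add: sinr_eq Wz) (simp add: z_def)
  then have "central_constraint k H W < 0" for k
    using ratio_imp_cone_strict[OF _ target_pos load_pos, of k "hdot (H $ bs k $ k) (W $ k)" H W k]
    by (simp add: central_constraint_def signal_def sinr_eq Wz)
  then show thesis by (rule that)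
qed

lemma strictly_feasible_local:
  assumes "strictly_feasible bs \<sigma> \<gamma> H"
  obtains W t where "\<And>i. local_constraint i H (W, t) < 0" "consensus bs t = t"
proof -
  obtain W where W: "\<And>k. central_constraint k H W < 0"
    using strictly_feasible_central[OF assms] by blast
  define n where "n k = real (card (UNIV - {bs k}))" for k
  have "eventually (\<lambda>e. sqrt (\<gamma> k) * sqrt ((norm (load H W k))\<^sup>2 + n k * e) < signal H W k) (at_right 0)" for k
  proof (rule order_tendstoD(2))
    show "((\<lambda>e. sqrt (\<gamma> k) * sqrt ((norm (load H W k))\<^sup>2 + n k * e))
      \<longlongrightarrow> sqrt (\<gamma> k) * sqrt ((norm (load H W k))\<^sup>2 + n k * 0)) (at_right 0)"
      by (intro tendsto_intros)
    show "sqrt (\<gamma> k) * sqrt ((norm (load H W k))\<^sup>2 + n k * 0) < signal H W k"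
      using W[of k] by (simp add: central_constraint_def)
  qed
  \<comment> \<open>a single slack e serves all users, as there are finitely many\<close>
  then have "eventually (\<lambda>e. \<forall>k. sqrt (\<gamma> k) * sqrt ((norm (load H W k))\<^sup>2 + n k * e) < signal H W k) (at_right 0)"
    by (simp add: eventually_all_finite)
  with eventually_at_right_less[of "0::real"]
  have "eventually (\<lambda>e. 0 < e \<and> (\<forall>k. sqrt (\<gamma> k) * sqrt ((norm (load H W k))\<^sup>2 + n k * e) < signal H W k)) (at_right 0)"
    by eventually_elim simp
  then obtain e where e: "e > 0" "\<And>k. sqrt (\<gamma> k) * sqrt ((norm (load H W k))\<^sup>2 + n k * e) < signal H W k"
    using eventually_happens[of _ "at_right (0::real)"] by auto
  have "local_constraint i H (W, leak_copies e H W) < 0" for i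
  proof (cases i rule: sum.exhaust[case_names Inl Inr])
    case (Inl k)
    have "norm (local_load H (W, leak_copies e H W) k) = sqrt ((norm (load H W k))\<^sup>2 + n k * e)"
      using norm_local_load_leak_copies[of e H W k] e(1)
      by (metis less_imp_le n_def norm_ge_zero real_sqrt_unique)
    then show ?thesis using e(2)[of k] by (simp add: Inl)
  next
    case (Inr bj)
    obtain b j where bj: "bj = (b, j)" by (cases bj)
    have "norm (leak H W b j) < sqrt ((norm (leak H W b j))\<^sup>2 + e)"
      using e(1) by (intro real_less_rsqrt) simp
    then show ?thesis using unit_pos by (auto simp: Inr bj leak_copies_nth)
  qed
  then show thesis using that consensus_leak_copies by blast
qed

lemma slater_family_local:
  assumes "\<And>H. H \<in> K \<Longrightarrow> strictly_feasible bs \<sigma> \<gamma> H"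
  shows "slater_family local_constraint UNIV K"
proof
  fix H assume "H \<in> K"
  from strictly_feasible_local[OF assms[OF this]]
  show "\<exists>z. \<forall>i\<in>UNIV. local_constraint i H z < 0" by metis
qed (auto intro: continuous_local_constraint convex_local_constraint)

lemma slater_family_central:
  assumes "\<And>H. H \<in> K \<Longrightarrow> strictly_feasible bs \<sigma> \<gamma> H"
  shows "slater_family central_constraint UNIV K"
proof
  fix H assume "H \<in> K"
  from strictly_feasible_central[OF assms[OF this]]
  show "\<exists>z. \<forall>i\<in>UNIV. central_constraint i H z < 0" by metis
qed (auto intro: continuous_central_constraint convex_central_constraint)

lemmas closed_local_set = slater_family.closed_Q[OF slater_family_local[of "{}", simplified]]
  and convex_local_set = slater_family.convex_Q[OF slater_family_local[of "{}", simplified]]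
  and closed_central_set = slater_family.closed_Q[OF slater_family_central[of "{}", simplified]]
  and convex_central_set = slater_family.convex_Q[OF slater_family_central[of "{}", simplified]]

lemma strict_point_interior:
  assumes "\<And>i. local_constraint i H z < 0"
  shows "z \<in> interior (local_set H)"
proof (rule interiorI)
  have "continuous_on UNIV (local_constraint i H)" for i
  proof -
    have "continuous_on UNIV (\<lambda>z. (H, z))" by (intro continuous_intros)
    from continuous_on_compose2[OF continuous_local_constraint this] show ?thesis by simp
  qed
  then have "open {z. local_constraint i H z < 0}" for i
    by (intro open_Collect_less continuous_on_const)
  then have "open (\<Inter>i. {z. local_constraint i H z < 0})" by (intro open_INT) auto
  then show "open {z. \<forall>i. local_constraint i H z < 0}" by (simp add: Collect_all_eq)
  show "z \<in> {z. \<forall>i. local_constraint i H z < 0}" using assms by simp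
  show "{z. \<forall>i. local_constraint i H z < 0} \<subseteq> local_set H"
    by (auto simp: sublevel_def intro: less_imp_le)
qed

lemma local_set_iff:
  "(W, t) \<in> local_set H \<longleftrightarrow>
     (\<forall>k. sqrt (\<gamma> k) * norm (local_load H (W, t) k) \<le> signal H W k) \<and>
     (\<forall>m k. m \<noteq> bs k \<longrightarrow> norm (leak H W m k) \<le> \<kappa> * t $ (m, m, k))"
  by (auto simp: sublevel_def split_sum_all)

lemma copies_agree:
  assumes "consensus bs t = t" "m \<noteq> bs k" shows "t $ (m, m, k) = t $ (bs k, m, k)"
proof -
  have "consensus bs t $ (m, m, k) = consensus bs t $ (bs k, m, k)"
    using assms(2) by (simp add: consensus_component)
  then show ?thesis by (simp only: assms(1))
qed

lemma central_to_local:
  assumes "W \<in> central_set H"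
  shows "(W, leak_copies 0 H W) \<in> local_set H"
proof -
  have "local_constraint i H (W, leak_copies 0 H W) \<le> 0" for i
  proof (cases i rule: sum.exhaust[case_names Inl Inr])
    case (Inl k)
    have "norm (local_load H (W, leak_copies 0 H W) k) = norm (load H W k)"
      using norm_local_load_leak_copies[of 0 H W k] by simp
    then show ?thesis using assms by (simp add: Inl sublevel_def central_constraint_def)
  next
    case (Inr bj)
    then show ?thesis using unit_pos by (cases bj) (auto simp: leak_copies_nth)
  qed
  then show ?thesis by (simp add: sublevel_def)
qed

text \<open>
  Copies in consensus dominate the interference they stand for, so the local constraints imply the
  centralized ones. If the centralized constraints are tight there is no room between the two, and the
  copies equal the interference amplitudes.
\<close>

lemma local_to_central:
  assumes "(W, t) \<in> local_set H" "consensus bs t = t"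
  shows "W \<in> central_set H"
    and "(\<And>k. central_constraint k H W = 0) \<Longrightarrow> t = leak_copies 0 H W"
proof -
  have leak: "norm (leak H W m k) \<le> \<kappa> * t $ (bs k, m, k)" if "m \<noteq> bs k" for m k
    using assms(1) that copies_agree[OF assms(2) that] unfolding local_set_iff by metis
  then have leak2: "(norm (leak H W m k))\<^sup>2 \<le> (\<kappa> * t $ (bs k, m, k))\<^sup>2" if "m \<noteq> bs k" for m k
    using that by (intro power_mono) auto
  have c: "sqrt (\<gamma> k) * norm (local_load H (W, t) k) \<le> signal H W k" for k
    using assms(1) by (simp add: local_set_iff)
  have le: "norm (load H W k) \<le> norm (local_load H (W, t) k)" for k
    by (rule power2_le_imp_le)
      (auto simp: norm_load_split norm_local_load intro!: sum_mono leak2)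
  have "sqrt (\<gamma> k) * norm (load H W k) \<le> signal H W k" for k
    using c[of k] le[of k] target_pos[of k]
    by (intro order_trans[OF mult_left_mono c]) auto
  then show "W \<in> central_set H" by (simp add: sublevel_def central_constraint_def)
  assume tight: "\<And>k. central_constraint k H W = 0"
  have eq: "norm (leak H W m k) = \<kappa> * t $ (bs k, m, k)" if m: "m \<noteq> bs k" for m k
  proof -
    have "norm (load H W k) = norm (local_load H (W, t) k)"
    proof (rule antisym[OF le])
      have "sqrt (\<gamma> k) * norm (local_load H (W, t) k) \<le> sqrt (\<gamma> k) * norm (load H W k)"
        using tight[of k] c[of k] by (simp add: central_constraint_def)
      then show "norm (local_load H (W, t) k) \<le> norm (load H W k)"
        using target_pos[of k] by (simp add: mult_le_cancel_left_pos)
    qed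
    then have "(norm (load H W k))\<^sup>2 = (norm (local_load H (W, t) k))\<^sup>2" by simp
    then have "(\<Sum>m\<in>UNIV - {bs k}. (norm (leak H W m k))\<^sup>2) = (\<Sum>m\<in>UNIV - {bs k}. (\<kappa> * t $ (bs k, m, k))\<^sup>2)"
      by (simp add: norm_load_split norm_local_load)
    then have "(norm (leak H W m k))\<^sup>2 = (\<kappa> * t $ (bs k, m, k))\<^sup>2"
      by (rule sum_mono_inv) (use leak2 m in auto)
    then show ?thesis
      using leak[OF m] by (metis norm_ge_zero order_trans power2_eq_imp_eq)
  qed
  show "t = leak_copies 0 H W"
  proof -
    have "consensus bs t $ (l, m, k) = leak_copies 0 H W $ (l, m, k)" for l m k
    proof -
      have "t $ (bs k, m, k) = norm (leak H W m k) / \<kappa>" if "m \<noteq> bs k"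
        using eq[OF that] unit_pos by simp
      then show ?thesis
        using copies_agree[OF assms(2), of m k] by (simp add: consensus_component leak_copies_nth)
    qed
    then show ?thesis by (simp add: vec_eq_iff assms(2))
  qed
qed

definition optimum :: "('n::finite, 'k, 'b) channels \<Rightarrow> ('n, 'k) beams" where
  "optimum H = closest_point (central_set H) 0"

lemma optimum_in:
  assumes "strictly_feasible bs \<sigma> \<gamma> H"
  shows "optimum H \<in> central_set H"
  unfolding optimum_def
  using slater_family.Q_nonempty[OF slater_family_central[of "{H}"], of H] assms
  by (intro closest_point_in_set closed_central_set) auto

lemma optimum_eqI:
  assumes "W \<in> central_set H" "\<And>W'. W' \<in> central_set H \<Longrightarrow> norm W \<le> norm W'"
  shows "W = optimum H"
  unfolding optimum_def using assms
  by (intro closest_point_unique convex_central_set closed_central_set) auto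

lemma total_power_eq: "total_power bs W = (norm W)\<^sup>2"
proof -
  have "total_power bs W = (\<Sum>b\<in>UNIV. sum (\<lambda>k. (norm (W $ k))\<^sup>2) {k \<in> UNIV. bs k = b})"
    by (simp add: total_power_def users_def)
  also have "\<dots> = (\<Sum>k\<in>UNIV. (norm (W $ k))\<^sup>2)" by (rule sum.group) auto
  finally show ?thesis by (simp add: norm_vec_sq)
qed

lemma optimal_beams_eq_optimum:
  assumes "optimal_beams bs \<sigma> \<gamma> H W"
  shows "W = optimum H"
proof (rule optimum_eqI)
  have "sqrt (\<gamma> k) * norm (load H W k) \<le> Re (hdot (H $ bs k $ k) (W $ k))" for k
    using assms target_pos[of k] load_pos[of H W k]
    by (intro ratio_imp_cone) (auto simp: optimal_beams_def feasible_def phase_fixed_def sinr_eq less_imp_le)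
  then show "W \<in> central_set H"
    by (simp add: sublevel_def central_constraint_def signal_def)
  fix W' assume "W' \<in> central_set H"
  then have "\<gamma> k \<le> sinr bs \<sigma> H W' k" for k
    unfolding sinr_eq
    by (intro cone_imp_ratio target_pos load_pos) (simp add: sublevel_def central_constraint_def signal_def)
  then have "total_power bs W \<le> total_power bs W'"
    using assms by (auto simp: optimal_beams_def feasible_def)
  then show "norm W \<le> norm W'" by (simp add: total_power_eq)
qed

text \<open>
  A user with slack can shrink its beam-former until its constraint is tight. This lowers the
  interference at all other users and the total power.
\<close>

lemma optimum_tight:
  assumes "strictly_feasible bs \<sigma> \<gamma> H"
  shows "central_constraint k H (optimum H) = 0"
proof (rule ccontr)
  define W where "W = optimum H"
  have W: "central_constraint j H W \<le> 0" for j
    using optimum_in[OF assms] by (simp add: sublevel_def W_def)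
  assume "\<not> ?thesis"
  then have slack: "sqrt (\<gamma> k) * norm (load H W k) < signal H W k"
    using W[of k] by (simp add: central_constraint_def W_def)
  have pos: "0 < sqrt (\<gamma> k) * norm (load H W k)"
    by (intro mult_pos_pos real_sqrt_gt_zero target_pos load_pos)
  \<comment> \<open>the factor that makes the constraint of user k tight\<close>
  define c where "c = sqrt (\<gamma> k) * norm (load H W k) / signal H W k"
  have c: "0 < c" "c < 1" using pos slack by (auto simp: c_def)
  define V where "V = (\<chi> i. if i = k then c *\<^sub>R W $ k else W $ i)"
  have gains: "gain bs H V i j \<le> gain bs H W i j" for i j
  proof -
    have "cmod (hdot (H $ bs i $ j) (V $ i)) \<le> cmod (hdot (H $ bs i $ j) (W $ i))"
    proof (cases "i = k")
      case True
      then have "cmod (hdot (H $ bs i $ j) (V $ i)) = c * cmod (hdot (H $ bs i $ j) (W $ i))"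
        using c by (simp add: V_def hdot_scaleR)
      then show ?thesis using c by (simp add: mult_left_le_one_le)
    qed (simp add: V_def)
    then show ?thesis unfolding gain_def by (intro power_mono) auto
  qed
  have loads: "norm (load H V j) \<le> norm (load H W j)" for j
    by (rule power2_le_imp_le) (auto simp: norm_load intro!: sum_mono gains)
  have "central_constraint j H V \<le> 0" for j
  proof -
    have 1: "sqrt (\<gamma> j) * norm (load H V j) \<le> sqrt (\<gamma> j) * norm (load H W j)"
      using loads target_pos[of j] by (intro mult_left_mono) auto
    show ?thesis
    proof (cases "j = k")
      case True
      have "signal H V k = sqrt (\<gamma> k) * norm (load H W k)"
      proof -
        have "signal H V k = c * signal H W k" by (simp add: signal_def V_def hdot_scaleR)
        then show ?thesis using pos slack by (simp add: c_def)
      qed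
      then show ?thesis using 1 True by (simp add: central_constraint_def)
    next
      case False
      then have "signal H V j = signal H W j" by (simp add: signal_def V_def)
      then show ?thesis using 1 W[of j] by (simp add: central_constraint_def)
    qed
  qed
  then have "V \<in> central_set H" by (simp add: sublevel_def)
  then have "norm W \<le> norm V"
    using closest_point_le[OF closed_central_set, of V H 0] by (simp add: W_def optimum_def)
  then have "(norm W)\<^sup>2 \<le> (norm V)\<^sup>2" by (intro power_mono) auto
  moreover have "(norm V)\<^sup>2 < (norm W)\<^sup>2"
    unfolding norm_vec_sq[of V] norm_vec_sq[of W]
  proof (rule sum_strict_mono_ex1)
    have c2: "c\<^sup>2 < 1" using c by (simp add: power_less_one_iff)
    show "\<forall>i\<in>UNIV. (norm (V $ i))\<^sup>2 \<le> (norm (W $ i))\<^sup>2"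
      using c by (auto simp: V_def mult_left_le_one_le)
    have "W $ k \<noteq> 0" using pos slack by (auto simp: signal_def hdot_def)
    then have "(norm (V $ k))\<^sup>2 < (norm (W $ k))\<^sup>2"
      using c2 by (simp add: V_def power_mult_distrib)
    then show "\<exists>i\<in>UNIV. (norm (V $ i))\<^sup>2 < (norm (W $ i))\<^sup>2" by blast
  qed simp
  ultimately show False by linarith
qed

end

section \<open>Fixed points of the step\<close>

context network
begin

sublocale orthogonal_projection "consensus bs"
  by (rule orthogonal_projection_consensus)

text \<open>
  The first-order optimality condition for minimizing \<open>\<parallel>w\<parallel>\<^sup>2 / 2 - \<nu> \<bullet> t\<close> over the local constraints;
  \<open>consensus bs \<nu> = 0\<close> says that the two copies of a link have opposite prices.
\<close>

definition supports :: "('k, 'b) copies \<Rightarrow> ('n::finite, 'k, 'b) channels \<Rightarrow> ('n, 'k) beams \<times> ('k, 'b) copies \<Rightarrow> bool" where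
  "supports \<nu> H = (\<lambda>(w, t). consensus bs \<nu> = 0 \<and>
     (\<forall>w' t'. (w', t') \<in> local_set H \<longrightarrow> \<nu> \<bullet> (t' - t) \<le> w \<bullet> (w' - w)))"

abbreviation optimal_pair :: "('n::finite, 'k, 'b) channels \<Rightarrow> ('n, 'k) beams \<times> ('k, 'b) copies" where
  "optimal_pair H \<equiv> (optimum H, leak_copies 0 H (optimum H))"

lemma optimum_dot:
  assumes "W' \<in> central_set H"
  shows "optimum H \<bullet> (W' - optimum H) \<ge> 0"
  using closest_point_dot[OF convex_central_set closed_central_set assms, of 0]
  by (simp add: optimum_def)

lemma optimum_dot_eqI:
  assumes "W \<in> central_set H" "\<And>W'. W' \<in> central_set H \<Longrightarrow> W \<bullet> (W' - W) \<ge> 0"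
  shows "W = optimum H"
proof (rule optimum_eqI[OF assms(1)])
  fix W' assume "W' \<in> central_set H"
  then have "W \<bullet> W \<le> W \<bullet> W'" using assms(2) by (simp add: inner_diff_right)
  also have "\<dots> \<le> norm W * norm W'" by (rule norm_cauchy_schwarz)
  finally have "norm W * norm W \<le> norm W * norm W'" by (simp add: norm_eq_sqrt_inner)
  then show "norm W \<le> norm W'" by (cases "W = 0") auto
qed

lemma multiplier_of_optimum:
  assumes sf: "strictly_feasible bs \<sigma> \<gamma> H"
  obtains \<nu> where "supports \<nu> H (optimal_pair H)"
proof -
  obtain W t where Wt: "\<And>i. local_constraint i H (W, t) < 0" "consensus bs t = t"
    using strictly_feasible_local[OF sf] by blast
  have mem: "optimal_pair H \<in> local_set H" by (rule central_to_local[OF optimum_in[OF sf]])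
  show thesis
  proof (rule multiplier_exists[OF convex_local_set mem consensus_leak_copies _ strict_point_interior[OF Wt(1)] Wt(2)])
    show "optimum H \<bullet> (w' - optimum H) \<ge> 0" if "(w', t') \<in> local_set H" "consensus bs t' = t'" for w' t'
      by (rule optimum_dot[OF local_to_central(1)[OF that]])
    fix \<nu> assume "consensus bs \<nu> = 0"
      "\<And>w' t'. (w', t') \<in> local_set H \<Longrightarrow> \<nu> \<bullet> (t' - leak_copies 0 H (optimum H)) \<le> optimum H \<bullet> (w' - optimum H)"
    then show thesis by (intro that[of \<nu>]) (auto simp: supports_def)
  qed
qed

text \<open>
  The residual of the projection at \<open>t + \<nu>\<close> is the price \<open>\<nu>\<close>, so the variational inequality for
  \<open>\<nu>\<close> is the one that characterizes the projection.
\<close>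

lemma prox_of_multiplier:
  assumes sf: "strictly_feasible bs \<sigma> \<gamma> H" and \<nu>: "supports \<nu> H (optimal_pair H)"
  defines "v \<equiv> leak_copies 0 H (optimum H) + \<nu>"
  shows "prox (local_set H) v = optimal_pair H" "step (local_set H) v = v"
proof -
  show *: "prox (local_set H) v = optimal_pair H"
    using \<nu> central_to_local[OF optimum_in[OF sf]]
    by (intro prox_eqI convex_local_set closed_local_set) (auto simp: supports_def v_def)
  show "step (local_set H) v = v"
    using \<nu> unfolding step_fixed_iff * by (simp add: consensus_leak_copies supports_def v_def)
qed

text \<open>
  At a fixed point the copies are in consensus and the residual is orthogonal to all copies in
  consensus. The price term therefore drops out of the variational inequality for competitors of the
  centralized problem, so the beam-formers solve that problem; its tight constraints determine the
  copies.
\<close>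

lemma fixed_point_supports:
  assumes sf: "strictly_feasible bs \<sigma> \<gamma> H" and v: "step (local_set H) v = v"
  shows "supports (v - leak_copies 0 H (optimum H)) H (optimal_pair H)"
proof -
  obtain w t where J: "prox (local_set H) v = (w, t)" by (cases "prox (local_set H) v")
  have Pt: "consensus bs t = t" and Pv: "consensus bs (v - t) = 0"
    using v unfolding step_fixed_iff by (auto simp: J)
  have "local_set H \<noteq> {}" using central_to_local[OF optimum_in[OF sf]] by blast
  then have mem: "(w, t) \<in> local_set H"
    using closest_point_in_set[OF closed_local_set, of H "(0, v)"] J by (simp add: prox_def)
  have VI: "(v - t) \<bullet> (t' - t) \<le> w \<bullet> (w' - w)" if "(w', t') \<in> local_set H" for w' t'
    using closest_point_dot[OF convex_local_set closed_local_set that, of "(0, v)"] J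
    by (simp add: prox_def inner_diff_right inner_diff_left)
  have w: "w = optimum H"
  proof (rule optimum_dot_eqI)
    show "w \<in> central_set H" by (rule local_to_central(1)[OF mem Pt])
    fix W' assume "W' \<in> central_set H"
    then have "(v - t) \<bullet> (leak_copies 0 H W' - t) \<le> w \<bullet> (W' - w)"
      by (intro VI central_to_local)
    moreover have "(v - t) \<bullet> (leak_copies 0 H W' - t) = consensus bs (v - t) \<bullet> (leak_copies 0 H W' - t)"
      using P_selfadjoint[of "v - t" "leak_copies 0 H W' - t"] P_diff[of "leak_copies 0 H W'" t]
      by (simp only: consensus_leak_copies Pt)
    ultimately show "w \<bullet> (W' - w) \<ge> 0" by (simp add: Pv)
  qed
  have "t = leak_copies 0 H w"
    using local_to_central(2)[OF mem Pt] optimum_tight[OF sf] w by blast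
  then show ?thesis using Pv VI w by (auto simp: supports_def)
qed

end

section \<open>Uniqueness of the prices\<close>

text \<open>
  In a vector of the kernel, the row of an entry of maximal modulus cannot sum to zero.
\<close>

lemma diagonally_dominant_invertible:
  fixes A :: "real ^ 'm ^ 'm"
  assumes dom: "\<And>i. (\<Sum>j\<in>UNIV - {i}. \<bar>A $ i $ j\<bar>) < A $ i $ i"
  shows "invertible A"
proof -
  have "x = 0" if x: "A *v x = 0" for x
  proof (rule ccontr)
    assume "x \<noteq> 0"
    have "Max (range (\<lambda>j. \<bar>x $ j\<bar>)) \<in> range (\<lambda>j. \<bar>x $ j\<bar>)" by (rule Max_in) auto
    then obtain i where "Max (range (\<lambda>j. \<bar>x $ j\<bar>)) = \<bar>x $ i\<bar>" unfolding image_iff by blast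
    then have i: "\<bar>x $ j\<bar> \<le> \<bar>x $ i\<bar>" for j
      using Max_ge[of "range (\<lambda>j. \<bar>x $ j\<bar>)" "\<bar>x $ j\<bar>"] by simp
    have pos: "\<bar>x $ i\<bar> > 0"
    proof -
      obtain j where "x $ j \<noteq> 0" using \<open>x \<noteq> 0\<close> by (auto simp: vec_eq_iff)
      then show ?thesis using i[of j] by linarith
    qed
    have "A $ i $ i * x $ i + (\<Sum>j\<in>UNIV - {i}. A $ i $ j * x $ j) = (A *v x) $ i"
      by (simp add: matrix_vector_mult_def sum.remove[of UNIV i])
    then have "A $ i $ i * x $ i = - (\<Sum>j\<in>UNIV - {i}. A $ i $ j * x $ j)" using x by simp
    then have "\<bar>A $ i $ i * x $ i\<bar> = \<bar>\<Sum>j\<in>UNIV - {i}. A $ i $ j * x $ j\<bar>" by simp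
    also have "\<dots> \<le> (\<Sum>j\<in>UNIV - {i}. \<bar>A $ i $ j\<bar> * \<bar>x $ i\<bar>)"
      by (rule order_trans[OF sum_abs sum_mono]) (simp add: abs_mult i mult_left_mono)
    also have "\<dots> < A $ i $ i * \<bar>x $ i\<bar>"
      using dom[of i] pos by (simp flip: sum_distrib_right)
    also have "\<dots> \<le> \<bar>A $ i $ i * x $ i\<bar>" by (simp add: abs_mult mult_right_mono)
    finally show False by simp
  qed
  then show ?thesis
    unfolding invertible_left_inverse matrix_left_invertible_ker by blast
qed

lemma sum_triples:
  "(\<Sum>c\<in>UNIV. f c) = (\<Sum>l\<in>UNIV. \<Sum>m\<in>UNIV. \<Sum>k\<in>UNIV. f (l :: 'a::finite, m :: 'b::finite, k :: 'c::finite))"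
  by (simp add: sum.cartesian_product flip: UNIV_Times_UNIV)

context network
begin

text \<open>
  If the power of each user \<open>i\<close> is multiplied by \<open>1 + x q\<^sub>i\<close>, then \<open>inner_matrix\<close> times \<open>x q\<close> is the
  change of the interference power from other cells that each user can tolerate, and \<open>cross_matrix\<close> times
  \<open>x q\<close> is the change of the interference power from other cells that it receives. Both statements
  refer to beam-formers with tight constraints.
\<close>

definition inner_matrix :: "('n::finite, 'k, 'b) channels \<Rightarrow> ('n, 'k) beams \<Rightarrow> real ^ 'k ^ 'k" where
  "inner_matrix H W = (\<chi> k i. if i = k then (norm (load H W k))\<^sup>2
     else if bs i = bs k then - gain bs H W i k else 0)"

definition cross_matrix :: "('n::finite, 'k, 'b) channels \<Rightarrow> ('n, 'k) beams \<Rightarrow> real ^ 'k ^ 'k" where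
  "cross_matrix H W = (\<chi> k i. if bs i \<noteq> bs k then gain bs H W i k else 0)"

lemma inner_matrix_mult:
  "(inner_matrix H W *v q) $ k
     = (norm (load H W k))\<^sup>2 * q $ k - (\<Sum>i\<in>users bs (bs k) - {k}. gain bs H W i k * q $ i)"
proof -
  have "(inner_matrix H W *v q) $ k = (norm (load H W k))\<^sup>2 * q $ k
      + (\<Sum>i\<in>UNIV - {k}. inner_matrix H W $ k $ i * q $ i)"
    by (simp add: matrix_vector_mult_def sum.remove[of UNIV k]) (simp add: inner_matrix_def)
  also have "(\<Sum>i\<in>UNIV - {k}. inner_matrix H W $ k $ i * q $ i)
      = (\<Sum>i\<in>UNIV - {k}. if bs i = bs k then - (gain bs H W i k * q $ i) else 0)"
    by (rule sum.cong) (auto simp: inner_matrix_def)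
  also have "\<dots> = (\<Sum>i\<in>users bs (bs k) - {k}. - (gain bs H W i k * q $ i))"
    by (rule sum.mono_neutral_cong_right) (auto simp: users_def)
  finally show ?thesis by (simp add: sum_negf)
qed

lemma cross_matrix_mult:
  "(cross_matrix H W *v q) $ k = (\<Sum>m\<in>UNIV - {bs k}. \<Sum>i\<in>users bs m. gain bs H W i k * q $ i)"
proof -
  have "(\<Sum>m\<in>UNIV - {bs k}. \<Sum>i\<in>users bs m. gain bs H W i k * q $ i)
      = (\<Sum>m\<in>UNIV - {bs k}. sum (\<lambda>i. gain bs H W i k * q $ i) {i \<in> {i. bs i \<noteq> bs k}. bs i = m})"
    by (rule sum.cong) (auto simp: users_def intro!: sum.cong)
  also have "\<dots> = sum (\<lambda>i. gain bs H W i k * q $ i) {i. bs i \<noteq> bs k}"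
    by (rule sum.group) auto
  also have "\<dots> = (cross_matrix H W *v q) $ k"
    by (simp add: matrix_vector_mult_def cross_matrix_def if_distrib[of "\<lambda>x. x * _"] sum_masked cong: if_cong)
  finally show ?thesis ..
qed

lemma gain_nonneg: "gain bs H W i k \<ge> 0"
  by (simp add: gain_def)

lemma inner_matrix_invertible: "invertible (inner_matrix H W)"
proof (rule diagonally_dominant_invertible)
  fix k
  have "(\<Sum>i\<in>UNIV - {k}. \<bar>inner_matrix H W $ k $ i\<bar>) \<le> (\<Sum>i\<in>UNIV - {k}. gain bs H W i k)"
    by (intro sum_mono) (auto simp: inner_matrix_def gain_nonneg)
  also have "\<dots> < inner_matrix H W $ k $ k"
    using noise_pos[of k] by (simp add: inner_matrix_def norm_load)
  finally show "(\<Sum>i\<in>UNIV - {k}. \<bar>inner_matrix H W $ k $ i\<bar>) < inner_matrix H W $ k $ k" .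
qed

text \<open>
  Row \<open>k\<close> sums to the noise power of user \<open>k\<close>, because the diagonal entry is the total interference
  plus noise and the other entries are the negated gains.
\<close>

lemma full_matrix_invertible: "invertible (inner_matrix H W - cross_matrix H W)"
proof (rule diagonally_dominant_invertible)
  fix k
  have "(\<Sum>i\<in>UNIV - {k}. \<bar>(inner_matrix H W - cross_matrix H W) $ k $ i\<bar>) \<le> (\<Sum>i\<in>UNIV - {k}. gain bs H W i k)"
    by (intro sum_mono) (auto simp: inner_matrix_def cross_matrix_def gain_nonneg)
  also have "\<dots> < (inner_matrix H W - cross_matrix H W) $ k $ k"
    using noise_pos[of k] by (simp add: inner_matrix_def cross_matrix_def norm_load)
  finally show "(\<Sum>i\<in>UNIV - {k}. \<bar>(inner_matrix H W - cross_matrix H W) $ k $ i\<bar>)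
      < (inner_matrix H W - cross_matrix H W) $ k $ k" .
qed

definition leak_change :: "('n::finite, 'k, 'b) channels \<Rightarrow> ('n, 'k) beams \<Rightarrow> real ^ 'k \<Rightarrow> 'b \<Rightarrow> 'k \<Rightarrow> real" where
  "leak_change H w q m j = (\<Sum>i\<in>users bs m. gain bs H w i j * q $ i)"

text \<open>
  A curve of feasible points through the optimal pair, along which only the copy of the link
  \<open>(m0, k0)\<close> at the serving station \<open>bs k0\<close> is moved freely, by \<open>s\<close> (in units of interference). Powers
  grow by the factors \<open>1 + x q\<^sub>i\<close>, where \<open>x\<close> is the change of the squared copy and \<open>q\<close> is chosen such that
  exactly user \<open>k0\<close> gains the tolerance \<open>x\<close>; the copies at the interfering stations follow the
  interference they describe.
\<close>

definition curve_beams :: "('n::finite, 'k) beams \<Rightarrow> real ^ 'k \<Rightarrow> real \<Rightarrow> ('n, 'k) beams" where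
  "curve_beams w q x = (\<chi> i. sqrt (1 + x * q $ i) *\<^sub>R w $ i)"

definition curve_copies ::
  "('n::finite, 'k, 'b) channels \<Rightarrow> ('n, 'k) beams \<Rightarrow> real ^ 'k \<Rightarrow> 'b \<Rightarrow> 'k \<Rightarrow> real \<Rightarrow> real \<Rightarrow> ('k, 'b) copies"
where
  "curve_copies H w q m0 k0 s x = (\<chi> c. case c of (l, m, j) \<Rightarrow>
     if m \<noteq> bs j \<and> l = m then sqrt ((norm (leak H w m j))\<^sup>2 + x * leak_change H w q m j) / \<kappa>
     else leak_copies 0 H w $ c + (if c = (bs k0, m0, k0) then s / \<kappa> else 0))"

text \<open>
  The SINR constraints remain tight along the curve, since \<open>q\<close> makes signal and interference grow by the
  same factor, and the interference constraints hold with equality by construction.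
\<close>

lemma curve_feasible:
  assumes tight: "\<And>k. central_constraint k H w = 0"
    and m0: "m0 \<noteq> bs k0"
    and q: "inner_matrix H w *v q = axis k0 1"
    and x: "x = (norm (leak H w m0 k0) + s)\<^sup>2 - (norm (leak H w m0 k0))\<^sup>2"
    and pos: "\<And>i. 1 + x * q $ i \<ge> 0"
  shows "(curve_beams w q x, curve_copies H w q m0 k0 s x) \<in> local_set H"
proof -
  let ?W = "curve_beams w q x" and ?t = "curve_copies H w q m0 k0 s x"
  have gain: "gain bs H ?W i k = gain bs H w i k * (1 + x * q $ i)" for i k
    using pos[of i] by (simp add: gain_def curve_beams_def hdot_scaleR power_mult_distrib)
  have sig: "signal H ?W k = sqrt (1 + x * q $ k) * (sqrt (\<gamma> k) * norm (load H w k))" for k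
    using tight[of k] by (simp add: signal_def curve_beams_def hdot_scaleR central_constraint_def)
  have leak: "(norm (leak H ?W m j))\<^sup>2 = (norm (leak H w m j))\<^sup>2 + x * leak_change H w q m j" for m j
    by (simp add: norm_leak gain leak_change_def distrib_left sum.distrib sum_distrib_left mult.left_commute)
  have copies: "(\<kappa> * ?t $ (bs k, m, k))\<^sup>2
      = (norm (leak H w m k))\<^sup>2 + (if m = m0 \<and> k = k0 then x else 0)" if "m \<noteq> bs k" for m k
    using that m0 unit_pos by (auto simp: curve_copies_def leak_copies_nth x distrib_left)
  have load: "norm (local_load H (?W, ?t) k) = sqrt (1 + x * q $ k) * norm (load H w k)" for k
  proof -
    define S where "S = (\<Sum>i\<in>users bs (bs k) - {k}. gain bs H w i k * q $ i)"
    have "(\<Sum>m\<in>UNIV - {bs k}. (\<kappa> * ?t $ (bs k, m, k))\<^sup>2)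
        = (\<Sum>m\<in>UNIV - {bs k}. (norm (leak H w m k))\<^sup>2 + (if m = m0 then (if k = k0 then x else 0) else 0))"
      by (rule sum.cong) (auto simp: copies)
    also have "\<dots> = (\<Sum>m\<in>UNIV - {bs k}. (norm (leak H w m k))\<^sup>2) + (if k = k0 then x else 0)"
      using m0 by (auto simp: sum.distrib)
    finally have "(norm (local_load H (?W, ?t) k))\<^sup>2 = (norm (load H w k))\<^sup>2 + x * S + (if k = k0 then x else 0)"
      by (simp add: norm_local_load norm_load_split gain S_def distrib_left sum.distrib sum_distrib_left mult.left_commute)
    moreover have "(norm (load H w k))\<^sup>2 * q $ k - S = (if k = k0 then 1 else 0)"
      using inner_matrix_mult[of H w q k] by (simp add: q S_def axis_def)
    then have "x * ((norm (load H w k))\<^sup>2 * q $ k - S) = (if k = k0 then x else 0)" by simp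
    ultimately have "(norm (local_load H (?W, ?t) k))\<^sup>2 = (norm (load H w k))\<^sup>2 * (1 + x * q $ k)"
      by (simp add: algebra_simps)
    also have "\<dots> = (sqrt (1 + x * q $ k) * norm (load H w k))\<^sup>2"
      using pos[of k] by (simp add: power_mult_distrib)
    finally show ?thesis by (rule power2_eq_imp_eq) (use pos[of k] in auto)
  qed
  show ?thesis
    unfolding local_set_iff
  proof (intro conjI allI impI)
    show "sqrt (\<gamma> k) * norm (local_load H (?W, ?t) k) \<le> signal H ?W k" for k
      by (simp add: load sig)
    show "norm (leak H ?W m k) \<le> \<kappa> * ?t $ (m, m, k)" if "m \<noteq> bs k" for m k
      using that unit_pos by (simp add: curve_copies_def flip: leak)
  qed
qed

lemma leak_change_zero: "leak H w m j = 0 \<Longrightarrow> leak_change H w q m j = 0"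
proof -
  assume "leak H w m j = 0"
  then have "(\<Sum>i\<in>users bs m. gain bs H w i j) = 0" using norm_leak[of H w m j] by simp
  then have "\<forall>i\<in>users bs m. gain bs H w i j = 0"
    by (subst (asm) sum_nonneg_eq_0_iff) (auto simp: gain_nonneg)
  then show ?thesis by (simp add: leak_change_def)
qed

text \<open>
  The derivative of \<open>curve_copies\<close> at \<open>s = 0\<close>, up to the factor \<open>\<kappa>\<close>. For a link without interference the
  quotient is \<open>0\<close>, which is the correct derivative, as such a link stays without interference along the
  curve.
\<close>

definition curve_direction ::
  "('n::finite, 'k, 'b) channels \<Rightarrow> ('n, 'k) beams \<Rightarrow> real ^ 'k \<Rightarrow> 'b \<Rightarrow> 'k \<Rightarrow> ('k, 'b) copies"
where
  "curve_direction H w q m0 k0 =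
     (\<chi> c. case c of (l, m, j) \<Rightarrow> if m \<noteq> bs j \<and> l = m
        then norm (leak H w m0 k0) * leak_change H w q m j / norm (leak H w m j) else 0)
     + axis (bs k0, m0, k0) 1"

text \<open>
  The optimal pair minimizes the linearized Lagrangian along the curve, which passes through it in both
  directions, so the derivative vanishes. The right-hand side is the derivative of the power and does
  not involve the prices.
\<close>

lemma curve_stationary:
  assumes tight: "\<And>k. central_constraint k H w = 0"
    and \<nu>: "supports \<nu> H (w, leak_copies 0 H w)"
    and m0: "m0 \<noteq> bs k0"
    and q: "inner_matrix H w *v q = axis k0 1"
  shows "\<nu> \<bullet> curve_direction H w q m0 k0
    = \<kappa> * (\<Sum>i\<in>UNIV. norm (leak H w m0 k0) * q $ i * (w $ i \<bullet> w $ i))"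
proof -
  define a where "a = norm (leak H w m0 k0)"
  define x where "x s = (a + s)\<^sup>2 - a\<^sup>2" for s
  \<comment> \<open>the slack of the optimality condition along the curve: nonnegative near 0 and zero at 0\<close>
  define \<phi> where "\<phi> s = (\<Sum>i\<in>UNIV. (sqrt (1 + x s * q $ i) - 1) * (w $ i \<bullet> w $ i))
      - (\<Sum>c\<in>UNIV. \<nu> $ c * (curve_copies H w q m0 k0 s (x s) $ c - leak_copies 0 H w $ c))" for s
  have x0: "x 0 = 0" by (simp add: x_def)
  have dx: "(x has_real_derivative 2 * a) (at 0)"
    unfolding x_def by (auto intro!: derivative_eq_intros)
  have dsqrt: "((\<lambda>s. sqrt (d + x s * e)) has_real_derivative a * e / sqrt d) (at 0)" if "d > 0" for d e
    using that by (auto intro!: derivative_eq_intros dx simp: x0 field_simps)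
  have dcopy: "((\<lambda>s. curve_copies H w q m0 k0 s (x s) $ c) has_real_derivative
      curve_direction H w q m0 k0 $ c / \<kappa>) (at 0)" for c
  proof -
    obtain l m j where c: "c = (l, m, j)" by (cases c)
    show ?thesis
    proof (cases "m \<noteq> bs j \<and> l = m")
      case True
      have *: "curve_copies H w q m0 k0 s (x s) $ c
          = sqrt ((norm (leak H w m j))\<^sup>2 + x s * leak_change H w q m j) / \<kappa>" for s
        using True by (simp add: curve_copies_def c)
      have dir: "curve_direction H w q m0 k0 $ c = a * leak_change H w q m j / norm (leak H w m j)"
        using True m0 by (auto simp: curve_direction_def c a_def axis_def)
      show ?thesis
      proof (cases "leak H w m j = 0")
        case True
        then show ?thesis unfolding * dir by (simp add: leak_change_zero)
      next
        case False
        then show ?thesis unfolding * dir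
          using DERIV_cdivide[OF dsqrt[of "(norm (leak H w m j))\<^sup>2" "leak_change H w q m j"], of \<kappa>] by simp
      qed
    next
      case False
      have *: "curve_copies H w q m0 k0 s (x s) $ c
          = leak_copies 0 H w $ c + (if c = (bs k0, m0, k0) then 1 else 0) * (s / \<kappa>)" for s
        using False by (auto simp: curve_copies_def c)
      have dir: "curve_direction H w q m0 k0 $ c = (if c = (bs k0, m0, k0) then 1 else 0)"
        using False by (auto simp: curve_direction_def c axis_def)
      show ?thesis unfolding * dir using unit_pos by (auto intro!: derivative_eq_intros)
    qed
  qed
  have "(\<phi> has_real_derivative (\<Sum>i\<in>UNIV. (a * q $ i) * (w $ i \<bullet> w $ i))
      - (\<Sum>c\<in>UNIV. \<nu> $ c * (curve_direction H w q m0 k0 $ c / \<kappa>))) (at 0)"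
  proof -
    have d1: "((\<lambda>s. sqrt (1 + x s * q $ i)) has_real_derivative a * q $ i) (at 0)" for i
      using dsqrt[of 1 "q $ i"] by simp
    have e1: "((\<lambda>s. (sqrt (1 + x s * q $ i) - 1) * (w $ i \<bullet> w $ i)) has_real_derivative
        (a * q $ i) * (w $ i \<bullet> w $ i)) (at 0)" for i
      using DERIV_cmult_right[OF DERIV_diff[OF d1[of i] DERIV_const[of 1]], of "w $ i \<bullet> w $ i"] by simp
    have e2: "((\<lambda>s. \<nu> $ c * (curve_copies H w q m0 k0 s (x s) $ c - leak_copies 0 H w $ c)) has_real_derivative
        \<nu> $ c * (curve_direction H w q m0 k0 $ c / \<kappa>)) (at 0)" for c
      using DERIV_cmult[OF DERIV_diff[OF dcopy[of c] DERIV_const], of "\<nu> $ c"] by simp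
    show ?thesis unfolding \<phi>_def by (intro DERIV_diff DERIV_sum e1 e2)
  qed
  moreover have "\<exists>d>0. \<forall>s. \<bar>0 - s\<bar> < d \<longrightarrow> \<phi> 0 \<le> \<phi> s"
  proof -
    have "eventually (\<lambda>s. 0 < 1 + x s * q $ i) (nhds 0)" for i
    proof (rule order_tendstoD(1))
      show "((\<lambda>s. 1 + x s * q $ i) \<longlongrightarrow> 1 + x 0 * q $ i) (nhds 0)"
        unfolding x_def by (intro tendsto_intros filterlim_ident)
      show "0 < 1 + x 0 * q $ i" by (simp add: x0)
    qed
    then have "eventually (\<lambda>s. \<forall>i. 0 < 1 + x s * q $ i) (nhds 0)"
      by (simp add: eventually_all_finite)
    then obtain d where d: "d > 0" "\<And>s. dist s 0 < d \<Longrightarrow> \<forall>i. 0 < 1 + x s * q $ i"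
      by (auto simp: eventually_nhds_metric)
    have "\<phi> 0 \<le> \<phi> s" if s: "\<bar>0 - s\<bar> < d" for s
    proof -
      have "1 + x s * q $ i \<ge> 0" for i using d(2)[of s] s by (simp add: dist_norm less_imp_le)
      then have "(curve_beams w q (x s), curve_copies H w q m0 k0 s (x s)) \<in> local_set H"
        by (intro curve_feasible[OF tight m0 q]) (auto simp: x_def a_def)
      then have "\<nu> \<bullet> (curve_copies H w q m0 k0 s (x s) - leak_copies 0 H w) \<le> w \<bullet> (curve_beams w q (x s) - w)"
        using \<nu> by (auto simp: supports_def)
      moreover have "w \<bullet> (curve_beams w q (x s) - w) = (\<Sum>i\<in>UNIV. (sqrt (1 + x s * q $ i) - 1) * (w $ i \<bullet> w $ i))"
        by (simp add: inner_vec_def[of w] curve_beams_def inner_diff_right left_diff_distrib sum_subtractf)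
      ultimately have "\<phi> s \<ge> 0" by (simp add: \<phi>_def inner_vec_def[of \<nu>])
      moreover have "curve_copies H w q m0 k0 0 0 = leak_copies 0 H w"
        by (auto simp: vec_eq_iff curve_copies_def leak_copies_nth)
      then have "\<phi> 0 = 0" by (simp add: \<phi>_def x0)
      ultimately show ?thesis by simp
    qed
    with d(1) show ?thesis by blast
  qed
  ultimately have "(\<Sum>i\<in>UNIV. (a * q $ i) * (w $ i \<bullet> w $ i))
      - (\<Sum>c\<in>UNIV. \<nu> $ c * (curve_direction H w q m0 k0 $ c / \<kappa>)) = 0"
    using DERIV_local_min by blast
  moreover have "(\<Sum>c\<in>UNIV. \<nu> $ c * (curve_direction H w q m0 k0 $ c / \<kappa>))
      = (\<nu> \<bullet> curve_direction H w q m0 k0) / \<kappa>"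
    by (simp add: inner_vec_def sum_divide_distrib)
  ultimately show ?thesis using unit_pos by (simp add: a_def field_simps)
qed

text \<open>
  A coordinate that no constraint reads can be moved in both directions at no cost, so its price is \<open>0\<close>.
\<close>

lemma supports_unlinked:
  assumes \<nu>: "supports \<nu> H (w, t)" and wt: "(w, t) \<in> local_set H" and c: "\<not> linked bs c"
  shows "\<nu> $ c = 0"
proof -
  have "(w, t + x *\<^sub>R axis c 1) \<in> local_set H" for x
  proof -
    have t: "(t + x *\<^sub>R axis c 1) $ (l, m, k) = t $ (l, m, k)" if "m \<noteq> bs k" "l = m \<or> l = bs k" for l m k
      using c that by (auto simp: axis_def linked_def)
    have "local_load H (w, t + x *\<^sub>R axis c 1) k = local_load H (w, t) k" for k
      using t[of _ k "bs k"] unfolding local_load_def by (auto simp: vec_eq_iff)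
    moreover have "(t + x *\<^sub>R axis c 1) $ (m, m, k) = t $ (m, m, k)" if "m \<noteq> bs k" for m k
      using t that by blast
    ultimately show ?thesis using wt unfolding local_set_iff by metis
  qed
  then have "\<nu> \<bullet> (x *\<^sub>R axis c 1) \<le> 0" for x
    using \<nu> by (force simp: supports_def)
  from this[of 1] this[of "-1"] show ?thesis by (simp add: inner_axis)
qed

text \<open>
  By \<open>curve_stationary\<close> the difference \<open>\<delta>\<close> of two price vectors is orthogonal to all curve directions. As
  \<open>\<delta>\<close> takes opposite values on the two copies of a link, this says
  \<open>n m k = a m k * \<Lambda> $ k\<close>, where \<open>a\<close> is the interference amplitude and \<open>\<Lambda> $ k\<close> is a combination of the
  values of \<open>n\<close>. Substituting this expression for \<open>n\<close> into \<open>\<Lambda>\<close> gives \<open>\<Lambda>\<^sup>T N M\<^sup>-\<^sup>1 = \<Lambda>\<^sup>T\<close> with the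
  matrices \<open>M\<close> of the gains within a cell and \<open>N\<close> of the gains across cells, that is
  \<open>\<Lambda>\<^sup>T (M - N) = 0\<close>, and \<open>M - N\<close> is invertible.
\<close>

lemma multiplier_unique:
  assumes sf: "strictly_feasible bs \<sigma> \<gamma> H"
    and 1: "supports \<nu>1 H (optimal_pair H)" and 2: "supports \<nu>2 H (optimal_pair H)"
  shows "\<nu>1 = \<nu>2"
proof -
  define w where "w = optimum H"
  define M where "M = inner_matrix H w"
  define N where "N = cross_matrix H w"
  define \<delta> where "\<delta> = \<nu>1 - \<nu>2"
  define n where "n m j = \<delta> $ (bs j, m, j)" for m j
  define a where "a m j = norm (leak H w m j)" for m j
  have tight: "central_constraint k H w = 0" for k
    unfolding w_def by (rule optimum_tight[OF sf])
  have wt: "(w, leak_copies 0 H w) \<in> local_set H"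
    unfolding w_def by (rule central_to_local[OF optimum_in[OF sf]])
  have s1: "supports \<nu>1 H (w, leak_copies 0 H w)" and s2: "supports \<nu>2 H (w, leak_copies 0 H w)"
    using 1 2 by (simp_all add: w_def)
  have "consensus bs \<delta> = 0" using s1 s2 by (simp add: \<delta>_def P_diff supports_def)
  then have opposite: "\<delta> $ (m, m, j) = - n m j" if "m \<noteq> bs j" for m j
    using that by (simp add: consensus_zero_iff n_def)
  obtain R where R: "M ** R = mat 1" "R ** M = mat 1"
    using inner_matrix_invertible[of H w] unfolding M_def invertible_def by blast
  define q where "q k = R *v axis k 1" for k
  have q: "M *v q k = axis k 1" for k
    by (simp add: q_def matrix_vector_mul_assoc R)
  define \<Lambda> where "\<Lambda> = (\<chi> k. \<Sum>m\<in>UNIV. \<Sum>j\<in>UNIV. if m \<noteq> bs j then n m j * leak_change H w (q k) m j / a m j else 0)"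
  have n_eq: "n m k = a m k * \<Lambda> $ k" if m: "m \<noteq> bs k" for m k
  proof -
    have "\<delta> \<bullet> curve_direction H w (q k) m k = 0"
      using curve_stationary[OF tight s1 m q[of k, unfolded M_def]]
        curve_stationary[OF tight s2 m q[of k, unfolded M_def]]
      by (simp add: \<delta>_def inner_diff_left)
    moreover define G where
      "G m' j = (if m' \<noteq> bs j then a m k * leak_change H w (q k) m' j / a m' j else 0)" for m' j
    have "\<delta> \<bullet> curve_direction H w (q k) m k
        = (\<Sum>c\<in>UNIV. \<delta> $ c * (case c of (l, m', j) \<Rightarrow> if l = m' then G m' j else 0)) + n m k"
      unfolding curve_direction_def inner_add_right inner_axis
      by (auto simp: inner_vec_def n_def a_def G_def intro!: sum.cong)
    moreover have "(\<Sum>c\<in>UNIV. \<delta> $ c * (case c of (l, m', j) \<Rightarrow> if l = m' then G m' j else 0))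
        = (\<Sum>l\<in>UNIV. \<Sum>m'\<in>UNIV. if l = m' then (\<Sum>j\<in>UNIV. \<delta> $ (m', m', j) * G m' j) else 0)"
      unfolding sum_triples by (intro sum.cong refl) auto
    moreover have "\<dots> = (\<Sum>m'\<in>UNIV. \<Sum>j\<in>UNIV. \<delta> $ (m', m', j) * G m' j)" by simp
    moreover have "\<dots> = (\<Sum>m'\<in>UNIV. \<Sum>j\<in>UNIV. - (a m k *
            (if m' \<noteq> bs j then n m' j * leak_change H w (q k) m' j / a m' j else 0)))"
      by (intro sum.cong refl) (simp add: opposite G_def)
    moreover have "\<dots> = - (a m k * \<Lambda> $ k)"
      by (simp add: \<Lambda>_def sum_distrib_left sum_negf)
    ultimately show ?thesis by linarith
  qed
  have \<Lambda>: "\<Lambda> $ k = \<Lambda> \<bullet> (N *v q k)" for k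
  proof -
    have *: "n m j * leak_change H w (q k) m j / a m j = \<Lambda> $ j * leak_change H w (q k) m j" if "m \<noteq> bs j" for m j
      using n_eq[OF that] leak_change_zero[of H w m j "q k"] by (cases "a m j = 0") (auto simp: a_def)
    have "\<Lambda> $ k = (\<Sum>m\<in>UNIV. \<Sum>j\<in>UNIV. if m \<noteq> bs j then n m j * leak_change H w (q k) m j / a m j else 0)"
      by (simp add: \<Lambda>_def)
    also have "\<dots> = (\<Sum>m\<in>UNIV. \<Sum>j\<in>UNIV. if m \<noteq> bs j then \<Lambda> $ j * leak_change H w (q k) m j else 0)"
      by (intro sum.cong refl if_cong *) simp
    also have "\<dots> = (\<Sum>j\<in>UNIV. \<Lambda> $ j * (\<Sum>m\<in>UNIV - {bs j}. leak_change H w (q k) m j))"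
      by (subst sum.swap) (intro sum.cong refl, simp add: sum_distrib_left, rule sum.mono_neutral_cong_right, auto)
    also have "\<dots> = \<Lambda> \<bullet> (N *v q k)"
      by (simp add: inner_vec_def N_def cross_matrix_mult leak_change_def)
    finally show ?thesis .
  qed
  have "\<Lambda> \<bullet> ((M - N) *v q k) = 0" for k
    using \<Lambda>[of k] by (simp add: matrix_vector_mult_diff_rdistrib q inner_diff_right inner_axis)
  then have "\<Lambda> v* ((M - N) ** R) = 0"
    using dot_lmul_matrix[of \<Lambda> "(M - N) ** R" "axis _ 1"]
    by (simp add: vec_eq_iff q_def inner_axis matrix_vector_mul_assoc)
  then have zero: "\<Lambda> \<bullet> (((M - N) ** R) *v y) = 0" for y
    using dot_lmul_matrix[of \<Lambda> "(M - N) ** R" y] by simp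
  obtain R' where R': "(M - N) ** R' = mat 1"
    using full_matrix_invertible[of H w] unfolding M_def N_def invertible_def by blast
  have "((M - N) ** R) *v (M *v (R' *v \<Lambda>)) = ((M - N) ** (R ** M) ** R') *v \<Lambda>"
    by (simp add: matrix_vector_mul_assoc matrix_mul_assoc)
  also have "\<dots> = \<Lambda>" by (simp add: R R')
  finally have "\<Lambda> \<bullet> \<Lambda> = 0" using zero[of "M *v (R' *v \<Lambda>)"] by simp
  then have "n m k = 0" if "m \<noteq> bs k" for m k using n_eq[OF that] by simp
  then have linked_zero: "\<delta> $ c = 0" if "linked bs c" for c
    using that opposite by (cases c) (auto simp: linked_def n_def)
  have "\<delta> $ c = 0" for c
    using linked_zero[of c] supports_unlinked[OF s1 wt, of c] supports_unlinked[OF s2 wt, of c]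
    by (cases "linked bs c") (auto simp: \<delta>_def)
  then show ?thesis by (simp add: \<delta>_def vec_eq_iff)
qed

end

section \<open>The equilibrium state\<close>

context network
begin

lemma fixed_point_unique:
  assumes "strictly_feasible bs \<sigma> \<gamma> H" "step (local_set H) u = u" "step (local_set H) v = v"
  shows "u = v"
  using multiplier_unique[OF assms(1) fixed_point_supports[OF assms(1,2)] fixed_point_supports[OF assms(1,3)]]
  by simp

definition equilibrium :: "('n::finite, 'k, 'b) channels \<Rightarrow> ('k, 'b) copies" where
  "equilibrium H = (SOME v. step (local_set H) v = v \<and> prox (local_set H) v = optimal_pair H)"

lemma equilibrium:
  assumes "strictly_feasible bs \<sigma> \<gamma> H"
  shows "step (local_set H) (equilibrium H) = equilibrium H"
    and "prox (local_set H) (equilibrium H) = optimal_pair H"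
proof -
  have "\<exists>v. step (local_set H) v = v \<and> prox (local_set H) v = optimal_pair H"
    using multiplier_of_optimum[OF assms] prox_of_multiplier[OF assms] by metis
  from someI_ex[OF this]
  show "step (local_set H) (equilibrium H) = equilibrium H"
    and "prox (local_set H) (equilibrium H) = optimal_pair H"
    by (simp_all add: equilibrium_def)
qed

lemma local_set_nonempty:
  "strictly_feasible bs \<sigma> \<gamma> H \<Longrightarrow> local_set H \<noteq> {}"
  using central_to_local[OF optimum_in] by blast

lemma step_nonexpansive:
  assumes "strictly_feasible bs \<sigma> \<gamma> H"
  shows "norm (step (local_set H) u - step (local_set H) v) \<le> norm (u - v)"
proof (rule power2_le_imp_le)
  have "0 \<le> (norm ((u - step (local_set H) u) - (v - step (local_set H) v)))\<^sup>2"
    "0 \<le> (norm (fst (prox (local_set H) u) - fst (prox (local_set H) v)))\<^sup>2" by simp_all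
  then show "(norm (step (local_set H) u - step (local_set H) v))\<^sup>2 \<le> (norm (u - v))\<^sup>2"
    using step_firmly_nonexpansive[OF convex_local_set closed_local_set local_set_nonempty[OF assms], of u v]
    by linarith
qed simp

text \<open>
  The equilibrium is fixed, so the strong convexity term of \<open>step_firmly_nonexpansive\<close> compares the
  beam-formers of any state with the optimal ones.
\<close>

lemma beams_distance:
  assumes "strictly_feasible bs \<sigma> \<gamma> H"
  shows "norm (fst (prox (local_set H) u) - optimum H) \<le> norm (u - equilibrium H)"
proof (rule power2_le_imp_le)
  let ?v = "equilibrium H"
  have "0 \<le> (norm ((u - step (local_set H) u) - (?v - step (local_set H) ?v)))\<^sup>2"
    "0 \<le> (norm (step (local_set H) u - step (local_set H) ?v))\<^sup>2"
    "0 \<le> (norm (fst (prox (local_set H) u) - optimum H))\<^sup>2" by simp_all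
  then show "(norm (fst (prox (local_set H) u) - optimum H))\<^sup>2 \<le> (norm (u - ?v))\<^sup>2"
    using step_firmly_nonexpansive[OF convex_local_set closed_local_set local_set_nonempty[OF assms], of u ?v]
    unfolding equilibrium(2)[OF assms] fst_conv by linarith
qed simp

text \<open>
  Firm nonexpansiveness turns any movement of \<open>u\<close> into a gain in distance, and by uniqueness the
  equilibrium is the only state that does not move.
\<close>

lemma step_strictly_approaches:
  assumes sf: "strictly_feasible bs \<sigma> \<gamma> H" and "u \<noteq> equilibrium H"
  shows "norm (step (local_set H) u - equilibrium H) < norm (u - equilibrium H)"
proof (rule power2_less_imp_less)
  let ?v = "equilibrium H"
  have "step (local_set H) u \<noteq> u"
    using fixed_point_unique[OF sf _ equilibrium(1)[OF sf]] assms(2) by blast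
  then have "0 < (norm ((u - step (local_set H) u) - (?v - step (local_set H) ?v)))\<^sup>2"
    by (simp add: equilibrium(1)[OF sf])
  moreover have "0 \<le> (norm (fst (prox (local_set H) u) - fst (prox (local_set H) ?v)))\<^sup>2" by simp
  ultimately show "(norm (step (local_set H) u - ?v))\<^sup>2 < (norm (u - ?v))\<^sup>2"
    using step_firmly_nonexpansive[OF convex_local_set closed_local_set local_set_nonempty[OF sf], of u ?v]
    unfolding equilibrium(1)[OF sf] by linarith
qed simp

lemma continuous_step:
  assumes "\<And>H. H \<in> K \<Longrightarrow> strictly_feasible bs \<sigma> \<gamma> H"
  shows "continuous_on (K \<times> UNIV) (\<lambda>(H :: ('n::finite, 'k, 'b) channels, u). step (local_set H) u)"
proof -
  have "continuous_on (K \<times> UNIV) (\<lambda>x :: ('n, 'k, 'b) channels \<times> ('k, 'b) copies. (fst x, (0, snd x)))"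
    by (intro continuous_intros)
  from continuous_on_compose2[OF slater_family.continuous_on_closest_point_Q[OF slater_family_local[OF assms]] this]
  have c: "continuous_on (K \<times> UNIV)
      (\<lambda>x :: ('n, 'k, 'b) channels \<times> ('k, 'b) copies. prox (local_set (fst x)) (snd x))"
    by (simp add: prox_def image_subset_iff mem_Times_iff)
  have P: "continuous_on (K \<times> UNIV) (\<lambda>x. consensus bs (f x))" if "continuous_on (K \<times> UNIV) f"
    for f :: "('n, 'k, 'b) channels \<times> ('k, 'b) copies \<Rightarrow> ('k, 'b) copies"
    by (rule linear_continuous_on_compose[OF that linear_P])
  show ?thesis
    unfolding case_prod_unfold step_def
    by (intro P continuous_on_add continuous_on_diff continuous_on_snd continuous_on_id c)
qed

end

section \<open>Iterations of the algorithm are steps\<close>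

context network
begin

text \<open>
  The algorithm leaves the coordinates outside the held links undetermined; the masked vectors carry
  all that the local problems read.
\<close>

definition mask :: "('k, 'b) copies \<Rightarrow> ('k, 'b) copies" where
  "mask t = (\<chi> c. if linked bs c then t $ c else 0)"

lemma mask_nth: "mask t $ (l, m, k) = (if m \<noteq> bs k \<and> (l = m \<or> l = bs k) then t $ (l, m, k) else 0)"
  by (simp add: mask_def linked_def)

lemma consensus_mask: "consensus bs (mask t) = consensus bs t" "mask (consensus bs t) = consensus bs t"
  by (auto simp: vec_eq_iff consensus_component mask_nth)

lemma mask_add_scale: "mask (x + c *\<^sub>R (y - z)) = mask x + c *\<^sub>R (mask y - mask z)"
  by (auto simp: vec_eq_iff mask_nth)

lemma sum_held:
  "(\<Sum>b\<in>UNIV. \<Sum>(m, k)\<in>held bs b. f (b, m, k)) = (\<Sum>c\<in>UNIV. if linked bs c then f c else 0 :: real)"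
proof -
  have "(\<Sum>(m, k)\<in>held bs b. f (b, m, k)) = (\<Sum>m\<in>UNIV. \<Sum>k\<in>UNIV. if linked bs (b, m, k) then f (b, m, k) else 0)" for b
  proof -
    have "(\<Sum>(m, k)\<in>held bs b. f (b, m, k)) = (\<Sum>x\<in>UNIV. if linked bs (b, x) then f (b, x) else 0)"
      by (rule sum.mono_neutral_cong_left) (auto simp: held_def linked_def)
    then show ?thesis by (simp add: sum.cartesian_product split_beta cong: if_cong flip: UNIV_Times_UNIV)
  qed
  then show ?thesis by (simp add: sum_triples)
qed

lemma local_sinr_mask: "local_sinr bs \<sigma> H W (mask t) k = local_sinr bs \<sigma> H W t k"
  by (simp add: local_sinr_def mask_nth)

lemma int_slack_leak: "int_slack bs H W t b j = (t $ (b, b, j))\<^sup>2 - (norm (leak H W b j))\<^sup>2"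
proof -
  have "(\<Sum>i\<in>users bs b. (cmod (hdot (H $ b $ j) (W $ i)))\<^sup>2) = (\<Sum>i\<in>users bs b. gain bs H W i j)"
    by (intro sum.cong refl) (auto simp: gain_def users_def)
  then show ?thesis by (simp add: int_slack_def norm_leak)
qed

lemma local_feasible_of_local_set:
  assumes "(W, t) \<in> local_set H"
  shows "local_feasible bs \<sigma> \<gamma> H b W (\<kappa> *\<^sub>R t)"
  unfolding local_feasible_def
proof (intro conjI ballI allI impI)
  show "\<gamma> k \<le> local_sinr bs \<sigma> H W (\<kappa> *\<^sub>R t) k" for k
    unfolding local_sinr_eq using assms
    by (intro cone_imp_ratio target_pos local_load_pos) (simp add: local_set_iff signal_def)
  fix j assume "j \<notin> users bs b"
  then have le: "norm (leak H W b j) \<le> \<kappa> * t $ (b, b, j)"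
    using assms by (auto simp: local_set_iff users_def)
  then have "(norm (leak H W b j))\<^sup>2 \<le> (\<kappa> * t $ (b, b, j))\<^sup>2" by (intro power_mono) auto
  then show "0 \<le> int_slack bs H W (\<kappa> *\<^sub>R t) b j" by (simp add: int_slack_leak)
  show "0 \<le> (\<kappa> *\<^sub>R t) $ (b, b, j)" using order_trans[OF norm_ge_zero le] by simp
qed

lemma local_set_of_local_feasible:
  assumes f: "\<And>b. local_feasible bs \<sigma> \<gamma> H b W t" and ph: "phase_fixed bs H W"
  shows "(W, (1 / \<kappa>) *\<^sub>R mask t) \<in> local_set H"
  unfolding local_set_iff
proof (intro conjI allI impI)
  have t: "\<kappa> *\<^sub>R ((1 / \<kappa>) *\<^sub>R mask t) = mask t" using unit_pos by simp
  show "sqrt (\<gamma> k) * norm (local_load H (W, (1 / \<kappa>) *\<^sub>R mask t) k) \<le> signal H W k" for k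
  proof -
    have "\<gamma> k \<le> local_sinr bs \<sigma> H W (mask t) k"
      using f[of "bs k"] by (simp add: local_feasible_def users_def local_sinr_mask)
    then show ?thesis
      using local_sinr_eq[of H W "(1 / \<kappa>) *\<^sub>R mask t" k, unfolded t] ph
      unfolding signal_def
      by (intro ratio_imp_cone target_pos local_load_pos) (auto simp: phase_fixed_def less_imp_le)
  qed
  show "norm (leak H W m k) \<le> \<kappa> * ((1 / \<kappa>) *\<^sub>R mask t) $ (m, m, k)" if "m \<noteq> bs k" for m k
  proof -
    have "(norm (leak H W m k))\<^sup>2 \<le> (t $ (m, m, k))\<^sup>2" "0 \<le> t $ (m, m, k)"
      using f[of m] that by (auto simp: local_feasible_def users_def int_slack_leak)
    then have "norm (leak H W m k) \<le> t $ (m, m, k)" by (rule power2_le_imp_le)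
    then show ?thesis using that unit_pos by (simp add: mask_nth)
  qed
qed

text \<open>
  Completing the square in the augmented Lagrangian shows that the local problems depend on \<open>\<tau>\<close> and
  \<open>\<nu>\<close> only through this vector.
\<close>

definition state :: "real \<Rightarrow> ('k, 'b) links \<Rightarrow> ('k, 'b) copies \<Rightarrow> ('k, 'b) copies" where
  "state \<rho> \<tau> \<nu> = (1 / \<kappa>) *\<^sub>R (copy_matrix bs *v \<tau> - (1 / \<rho>) *\<^sub>R mask \<nu>)"

lemma copy_matrix_nth:
  "(copy_matrix bs *v \<tau>) $ (l, m, k) = (if m \<noteq> bs k \<and> (l = m \<or> l = bs k) then \<tau> $ (m, k) else 0)"
  by (simp add: copy_matrix_mult)

lemma sum_local_objective:
  assumes \<rho>: "\<rho> > 0" and \<kappa>: "\<rho> * \<kappa>\<^sup>2 = 2"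
  shows "(\<Sum>b\<in>UNIV. local_objective bs \<rho> \<tau> \<nu> b W (\<kappa> *\<^sub>R t))
    = (norm W)\<^sup>2 + (norm (mask t - state \<rho> \<tau> \<nu>))\<^sup>2 - (norm (mask \<nu>))\<^sup>2 / (2 * \<rho>)"
proof -
  define e where "e c = \<kappa> * t $ c - (copy_matrix bs *v \<tau>) $ c" for c
  have lin: "(\<Sum>b\<in>UNIV. \<Sum>(m, k)\<in>held bs b.
        \<nu> $ (b, m, k) * ((\<kappa> *\<^sub>R t) $ (b, m, k) - (copy_matrix bs *v \<tau>) $ (b, m, k)))
      = (\<Sum>c\<in>UNIV. if linked bs c then \<nu> $ c * e c else 0)"
    using sum_held[of "\<lambda>c. \<nu> $ c * e c"] by (simp add: e_def)
  have quad: "(\<Sum>b\<in>UNIV. \<Sum>(m, k)\<in>held bs b.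
        ((\<kappa> *\<^sub>R t) $ (b, m, k) - (copy_matrix bs *v \<tau>) $ (b, m, k))\<^sup>2)
      = (\<Sum>c\<in>UNIV. if linked bs c then (e c)\<^sup>2 else 0)"
    using sum_held[of "\<lambda>c. (e c)\<^sup>2"] by (simp add: e_def)
  have "(\<Sum>b\<in>UNIV. local_objective bs \<rho> \<tau> \<nu> b W (\<kappa> *\<^sub>R t)) = (norm W)\<^sup>2
      + (\<Sum>c\<in>UNIV. if linked bs c then \<nu> $ c * e c else 0)
      + \<rho> / 2 * (\<Sum>c\<in>UNIV. if linked bs c then (e c)\<^sup>2 else 0)"
    unfolding local_objective_def sum.distrib sum_distrib_left[symmetric] lin quad
    using total_power_eq[of W] by (simp add: total_power_def)
  also have "\<dots> = (norm W)\<^sup>2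
      + (\<Sum>c\<in>UNIV. (if linked bs c then \<nu> $ c * e c else 0) + \<rho> / 2 * (if linked bs c then (e c)\<^sup>2 else 0))"
    by (simp add: sum.distrib sum_distrib_left)
  also have "(\<Sum>c\<in>UNIV. (if linked bs c then \<nu> $ c * e c else 0) + \<rho> / 2 * (if linked bs c then (e c)\<^sup>2 else 0))
      = (\<Sum>c\<in>UNIV. ((mask t - state \<rho> \<tau> \<nu>) $ c)\<^sup>2 - (mask \<nu> $ c)\<^sup>2 / (2 * \<rho>))"
  proof (rule sum.cong[OF refl])
    fix c
    show "(if linked bs c then \<nu> $ c * e c else 0) + \<rho> / 2 * (if linked bs c then (e c)\<^sup>2 else 0)
      = ((mask t - state \<rho> \<tau> \<nu>) $ c)\<^sup>2 - (mask \<nu> $ c)\<^sup>2 / (2 * \<rho>)"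
    proof (cases "linked bs c")
      case True
      have "(mask t - state \<rho> \<tau> \<nu>) $ c = (e c + \<nu> $ c / \<rho>) / \<kappa>"
        using True unit_pos by (simp add: mask_def state_def e_def field_simps)
      then have "((mask t - state \<rho> \<tau> \<nu>) $ c)\<^sup>2 = (e c + \<nu> $ c / \<rho>)\<^sup>2 / \<kappa>\<^sup>2"
        by (simp add: power_divide)
      also have "\<kappa>\<^sup>2 = 2 / \<rho>" using \<kappa> \<rho> by (simp add: field_simps)
      also have "(e c + \<nu> $ c / \<rho>)\<^sup>2 / (2 / \<rho>) = \<nu> $ c * e c + \<rho> / 2 * (e c)\<^sup>2 + (\<nu> $ c)\<^sup>2 / (2 * \<rho>)"
        using \<rho> by (simp add: power2_eq_square field_simps)
      finally show ?thesis using True by (simp add: mask_def)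
    next
      case False
      then have "(copy_matrix bs *v \<tau>) $ c = 0" by (cases c) (auto simp: copy_matrix_nth linked_def)
      with False show ?thesis by (simp add: mask_def state_def)
    qed
  qed
  finally show ?thesis 
    by (simp add: norm_vec_sq[of "mask t - state \<rho> \<tau> \<nu>"] norm_vec_sq[of "mask \<nu>"]
        sum_subtractf sum_divide_distrib)
qed

text \<open>
  The minimizers of the single base stations, put together, minimize the sum of the local objectives.
  Competitors range only over the convex set \<open>local_set H\<close>, which is enough because its points
  satisfy the local constraints and, by the choice of phases, it contains the minimizers.
\<close>

lemma prox_state:
  assumes \<rho>: "\<rho> > 0" "\<rho> * \<kappa>\<^sup>2 = 2"
    and min: "\<And>b. local_minimizer bs \<sigma> \<gamma> \<rho> H \<tau> \<nu> b W t" and ph: "phase_fixed bs H W"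
  shows "prox (local_set H) (state \<rho> \<tau> \<nu>) = (W, (1 / \<kappa>) *\<^sub>R mask t)"
proof -
  let ?u = "state \<rho> \<tau> \<nu>" and ?t = "(1 / \<kappa>) *\<^sub>R mask t"
  have mem: "(W, ?t) \<in> local_set H"
    using min by (intro local_set_of_local_feasible ph) (simp add: local_minimizer_def)
  have "dist (0, ?u) (W, ?t) \<le> dist (0, ?u) z" if z: "z \<in> local_set H" for z
  proof -
    obtain W' t' where zz: "z = (W', t')" by (cases z)
    have obj: "local_objective bs \<rho> \<tau> \<nu> b W (\<kappa> *\<^sub>R (1 / \<kappa>) *\<^sub>R t) = local_objective bs \<rho> \<tau> \<nu> b W t" for b
      using unit_pos by simp
    have "(\<Sum>b\<in>UNIV. local_objective bs \<rho> \<tau> \<nu> b W (\<kappa> *\<^sub>R (1 / \<kappa>) *\<^sub>R t))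
        \<le> (\<Sum>b\<in>UNIV. local_objective bs \<rho> \<tau> \<nu> b W' (\<kappa> *\<^sub>R t'))"
      unfolding obj using min z zz local_feasible_of_local_set[of W' t' H]
      by (intro sum_mono) (simp add: local_minimizer_def)
    then have "(norm W)\<^sup>2 + (norm (mask ((1 / \<kappa>) *\<^sub>R t) - ?u))\<^sup>2 \<le> (norm W')\<^sup>2 + (norm (mask t' - ?u))\<^sup>2"
      unfolding sum_local_objective[OF \<rho>] by simp
    also have "mask ((1 / \<kappa>) *\<^sub>R t) = ?t" by (auto simp: vec_eq_iff mask_nth)
    also have "(norm (mask t' - ?u))\<^sup>2 \<le> (norm (t' - ?u))\<^sup>2"
      unfolding norm_vec_sq[of "_ - ?u"]
    proof (rule sum_mono)
      fix c :: "'b \<times> 'b \<times> 'k"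
      show "(norm ((mask t' - ?u) $ c))\<^sup>2 \<le> (norm ((t' - ?u) $ c))\<^sup>2"
        by (cases c) (auto simp: mask_nth state_def copy_matrix_nth)
    qed
    finally have "(norm W)\<^sup>2 + (norm (?t - ?u))\<^sup>2 \<le> (norm W')\<^sup>2 + (norm (t' - ?u))\<^sup>2" by simp
    then show ?thesis
      by (simp add: zz dist_norm norm_Pair norm_minus_commute)
  qed
  then show ?thesis
    unfolding prox_def using closest_point_unique[OF convex_local_set closed_local_set mem] by metis
qed

lemma consensus_copy_matrix: "consensus bs (copy_matrix bs *v \<tau>) = copy_matrix bs *v \<tau>"
  by (auto simp: vec_eq_iff consensus_component copy_matrix_nth)

text \<open>
  The invariant \<open>consensus bs \<nu> = 0\<close> puts \<open>E \<tau>\<close> and \<open>\<nu>\<close> into complementary subspaces, so that both can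
  be read off from the state: they are its two components.
\<close>

lemma state_step:
  assumes \<rho>: "\<rho> > 0" "\<rho> * \<kappa>\<^sup>2 = 2"
    and min: "\<And>b. local_minimizer bs \<sigma> \<gamma> \<rho> H \<tau> \<nu> b W t" and ph: "phase_fixed bs H W"
    and \<nu>: "consensus bs \<nu> = 0"
    and \<tau>': "\<tau>' = pinv (copy_matrix bs) *v t"
    and \<nu>': "\<nu>' = \<nu> + \<rho> *\<^sub>R (t - copy_matrix bs *v \<tau>')"
  shows "state \<rho> \<tau>' \<nu>' = step (local_set H) (state \<rho> \<tau> \<nu>)"
    and "consensus bs \<nu>' = 0"
proof -
  have E: "copy_matrix bs *v \<tau>' = consensus bs t" by (simp add: \<tau>' consensus_def)
  have scale: "consensus bs (c *\<^sub>R y) = c *\<^sub>R consensus bs y" for c y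
    by (rule linear_scale[OF linear_P])
  show "consensus bs \<nu>' = 0"
    unfolding \<nu>' E by (simp add: P_add scale P_diff P_P \<nu>)
  have Pu: "consensus bs (state \<rho> \<tau> \<nu>) = (1 / \<kappa>) *\<^sub>R (copy_matrix bs *v \<tau>)"
    by (simp add: state_def scale P_diff consensus_copy_matrix consensus_mask \<nu>)
  have "step (local_set H) (state \<rho> \<tau> \<nu>) = (1 / \<kappa>) *\<^sub>R (2 *\<^sub>R consensus bs t - (1 / \<rho>) *\<^sub>R mask \<nu> - mask t)"
    unfolding step_def prox_state[OF \<rho> min ph] snd_conv P_diff Pu scale consensus_mask
    by (simp add: state_def algebra_simps scaleR_2)
  also have "\<dots> = state \<rho> \<tau>' \<nu>'"
    using \<rho>(1) unfolding state_def E \<nu>' mask_add_scale consensus_mask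
    by (simp add: algebra_simps scaleR_2)
  finally show "state \<rho> \<tau>' \<nu>' = step (local_set H) (state \<rho> \<tau> \<nu>)" ..
qed

end

section \<open>Convergence to a neighbourhood of the optimum\<close>

theorem theorem1:
  fixes bs :: "'k::finite \<Rightarrow> 'b::finite"
    and \<sigma> \<gamma> :: "'k \<Rightarrow> real"
    and \<rho> \<epsilon>\<^sub>1 \<epsilon>\<^sub>2 :: real
    and \<H> :: "('n::finite, 'k, 'b) channels set"
  assumes "\<And>k. \<sigma> k > 0"
    and "\<And>k. \<gamma> k > 0"
    and "\<rho> > 0"
    and "compact \<H>"
    and "\<And>H. H \<in> \<H> \<Longrightarrow> strictly_feasible bs \<sigma> \<gamma> H"
    and "\<epsilon>\<^sub>1 > 0"
    and "\<epsilon>\<^sub>2 > 0"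
  shows "\<exists>\<delta>>0. \<forall>(H :: nat \<Rightarrow> ('n, 'k, 'b) channels) W Wopt t \<tau> \<nu>.
           (\<forall>i. H i \<in> \<H>) \<longrightarrow>
           (\<forall>i\<ge>1. norm (H i - H (i - 1)) \<le> \<delta>) \<longrightarrow>
           admm_run bs \<sigma> \<gamma> \<rho> H W t \<tau> \<nu> \<longrightarrow>
           (\<forall>i. optimal_beams bs \<sigma> \<gamma> (H i) (Wopt i)) \<longrightarrow>
           limsup (\<lambda>i. ereal ((norm (W i - Wopt i))\<^sup>2)) \<le> ereal \<epsilon>\<^sub>1 \<and>
           (\<forall>k. liminf (\<lambda>i. ereal (local_sinr bs \<sigma> (H i) (W i) (t i) k)) \<ge> ereal (\<gamma> k - \<epsilon>\<^sub>2))"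
proof -
  \<comment> \<open>the unit in which the penalty of the copies has weight one\<close>
  define \<kappa> where "\<kappa> = sqrt (2 / \<rho>)"
  have \<kappa>: "\<kappa> > 0" "\<rho> * \<kappa>\<^sup>2 = 2" using \<open>\<rho> > 0\<close> by (simp_all add: \<kappa>_def)
  interpret network bs \<sigma> \<gamma> \<kappa>
    by unfold_locales (use assms \<kappa> in auto)
  note sf = assms(5)
  let ?T = "\<lambda>H :: ('n, 'k, 'b) channels. step (local_set H)"
  have "\<exists>\<delta>>0. \<forall>H u. (\<forall>i. H i \<in> \<H>) \<longrightarrow> (\<forall>i. dist (H (Suc i)) (H i) \<le> \<delta>) \<longrightarrow>
          (\<forall>i. u (Suc i) = ?T (H (Suc i)) (u i)) \<longrightarrow>
          eventually (\<lambda>i. norm (u i - equilibrium (H (Suc i))) \<le> sqrt \<epsilon>\<^sub>1) sequentially"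
  proof (rule fixed_point_tracking[OF continuous_step])
    show "compact \<H>" by fact
    show "0 < sqrt \<epsilon>\<^sub>1" using \<open>\<epsilon>\<^sub>1 > 0\<close> by simp
  qed (use sf in \<open>auto intro: step_nonexpansive equilibrium(1) step_strictly_approaches\<close>)
  then obtain \<delta> where "\<delta> > 0" and \<delta>: "\<And>H u. (\<And>i. H i \<in> \<H>) \<Longrightarrow> (\<And>i. dist (H (Suc i)) (H i) \<le> \<delta>) \<Longrightarrow>
      (\<And>i. u (Suc i) = ?T (H (Suc i)) (u i)) \<Longrightarrow>
      eventually (\<lambda>i. norm (u i - equilibrium (H (Suc i))) \<le> sqrt \<epsilon>\<^sub>1) sequentially"
    by auto
  show ?thesis
  proof (intro exI[of _ \<delta>] conjI allI impI)
    show "\<delta> > 0" by fact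
    fix H :: "nat \<Rightarrow> ('n, 'k, 'b) channels" and W Wopt t \<tau> \<nu>
    assume HK: "\<forall>i. H i \<in> \<H>" and slow: "\<forall>i\<ge>1. norm (H i - H (i - 1)) \<le> \<delta>"
      and run: "admm_run bs \<sigma> \<gamma> \<rho> H W t \<tau> \<nu>" and opt: "\<forall>i. optimal_beams bs \<sigma> \<gamma> (H i) (Wopt i)"
    have min: "local_minimizer bs \<sigma> \<gamma> \<rho> (H (Suc i)) (\<tau> i) (\<nu> i) b (W (Suc i)) (t (Suc i))"
      and ph: "phase_fixed bs (H (Suc i)) (W (Suc i))"
      and \<tau>: "\<tau> (Suc i) = pinv (copy_matrix bs) *v t (Suc i)"
      and \<nu>: "\<nu> (Suc i) = \<nu> i + \<rho> *\<^sub>R (t (Suc i) - copy_matrix bs *v \<tau> (Suc i))" for i b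
      using run[unfolded admm_run_def, THEN conjunct2, rule_format, of "Suc i"] by simp_all
    define u where "u i = state \<rho> (\<tau> i) (\<nu> i)" for i
    have "consensus bs (\<nu> 0) = 0"
      using run by (simp add: admm_run_def consensus_alt del: transpose_matrix_vector)
    then have P\<nu>: "consensus bs (\<nu> i) = 0" for i
    proof (induction i)
      case (Suc i)
      from Suc.IH[OF Suc.prems] show ?case
        by (rule state_step(2)[OF \<open>\<rho> > 0\<close> \<kappa>(2) min ph _ \<tau> \<nu>])
    qed
    have u: "u (Suc i) = ?T (H (Suc i)) (u i)" for i
      unfolding u_def by (rule state_step(1)[OF \<open>\<rho> > 0\<close> \<kappa>(2) min ph P\<nu> \<tau> \<nu>])
    have "eventually (\<lambda>i. norm (u i - equilibrium (H (Suc i))) \<le> sqrt \<epsilon>\<^sub>1) sequentially"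
    proof (rule \<delta>)
      show "dist (H (Suc i)) (H i) \<le> \<delta>" for i
        using slow[rule_format, of "Suc i"] by (simp add: dist_norm)
    qed (use HK u in auto)
    then have "eventually (\<lambda>i. (norm (W (Suc i) - Wopt (Suc i)))\<^sup>2 \<le> \<epsilon>\<^sub>1) sequentially"
    proof eventually_elim
      case (elim i)
      have "W (Suc i) = fst (prox (local_set (H (Suc i))) (u i))"
        using prox_state[OF \<open>\<rho> > 0\<close> \<kappa>(2) min ph] by (simp add: u_def)
      moreover have "Wopt (Suc i) = optimum (H (Suc i))"
        using opt by (intro optimal_beams_eq_optimum) simp
      ultimately have "norm (W (Suc i) - Wopt (Suc i)) \<le> norm (u i - equilibrium (H (Suc i)))"
        using beams_distance[OF sf, of "H (Suc i)" "u i"] HK by simp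
      with elim have "norm (W (Suc i) - Wopt (Suc i)) \<le> sqrt \<epsilon>\<^sub>1" by linarith
      then have "(norm (W (Suc i) - Wopt (Suc i)))\<^sup>2 \<le> (sqrt \<epsilon>\<^sub>1)\<^sup>2" by (intro power_mono) auto
      then show ?case using \<open>\<epsilon>\<^sub>1 > 0\<close> by simp
    qed
    then have "eventually (\<lambda>i. (norm (W i - Wopt i))\<^sup>2 \<le> \<epsilon>\<^sub>1) sequentially"
      by (rule eventually_sequentially_Suc[THEN iffD1])
    then show "limsup (\<lambda>i. ereal ((norm (W i - Wopt i))\<^sup>2)) \<le> ereal \<epsilon>\<^sub>1"
      by (intro Limsup_bounded) (simp)
    fix k
    have "\<gamma> k \<le> local_sinr bs \<sigma> (H (Suc i)) (W (Suc i)) (t (Suc i)) k" for i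
      using min[of i "bs k"] by (simp add: local_minimizer_def local_feasible_def users_def)
    then have "eventually (\<lambda>i. \<gamma> k \<le> local_sinr bs \<sigma> (H (Suc i)) (W (Suc i)) (t (Suc i)) k) sequentially"
      by simp
    then have "eventually (\<lambda>i. \<gamma> k \<le> local_sinr bs \<sigma> (H i) (W i) (t i) k) sequentially"
      by (rule eventually_sequentially_Suc[THEN iffD1])
    then have "eventually (\<lambda>i. ereal (\<gamma> k - \<epsilon>\<^sub>2) \<le> ereal (local_sinr bs \<sigma> (H i) (W i) (t i) k)) sequentially"
      by eventually_elim (use \<open>\<epsilon>\<^sub>2 > 0\<close> in simp)
    then show "ereal (\<gamma> k - \<epsilon>\<^sub>2) \<le> liminf (\<lambda>i. ereal (local_sinr bs \<sigma> (H i) (W i) (t i) k))"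
      by (rule Liminf_bounded)
  qed
qed

end
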